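(* Let $n\ge1$ and let $M$ be a deterministic, submodular and symmetric auction for $n$ items which is not degenerate, given by its normalized price schedule $q=\{q_I\}_{I\subseteq[n]}$. Suppose $q$ satisfies the following conditions for all nonempty $I\subseteq[n]$ (the regions $D_I$ and $\delta_n(I)$ being those of $q$): (1) if $I$ is not tight and $\mathrm{vol}_nD_I>0$, then $\delta_n(I)=0$; (2) if $I$ is not tight and $\mathrm{vol}_nD_I=0$, then $\delta_n(I)\ge0$; (3) if $I$ is left tight but not right tight, then $\delta_n(I)\ge0$; (4) if $I$ is right tight but not left tight and $\mathrm{vol}_nD_I>0$, then $\delta_n(I)\le0$. Then $M$ is the straight jacket auction (SJA) for $n$ items, i.e. $q$ equals the SJA price schedule.
   Context: Let $[n]=\{1,\dots,n\}$. A price schedule is a family of real numbers $\{p_I\}_{I\subseteq[n]}$ with $p_\emptyset=0$. Its regions are, for $I\subseteq[n]$, $$D_I=\Bigl\{x\in[0,1]^n\ \Big|\ \sum_{i\in I}x_i-p_I\ge\sum_{j\in J}x_j-p_J\text{ for all }J\subseteq[n]\Bigr\}.$$ Let $\pi_I$ be the projection onto the coordinates in $I$. Put $\bar D_I=\pi_I(D_I)$, $\bar D_I^i=\pi_{I\setminus\{i\}}(D_I)$ for $i\in I$, and $$\delta_n(I)=\mathrm{vol}_{\#I}\,\bar D_I-\frac1{n+1}\sum_{i\in I}\mathrm{vol}_{\#I-1}\,\bar D_I^i$$ ($\mathrm{vol}_0$ of a point is $1$, of the empty set $0$). A price schedule is submodular if $p_{I\cup J}+p_{I\cap J}\le p_I+p_J$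 for all $I,J\subseteq[n]$; symmetric if $p_I=p_J$ whenever $\#I=\#J$; normalized if $p_I=\min\{p_J\mid J\supsetneq I\}$ whenever $\mathrm{vol}_nD_I=0$ and $I\ne[n]$. Deterministic auctions are identified with normalized price schedules: a buyer with valuation $x\in[0,1]^n$ (i.i.d. uniform coordinates) who lies in $D_I$ receives the items in $I$ and pays $p_I$. An auction is submodular/symmetric if its price schedule is. For a submodular price schedule, if $I,J\subseteq[n]$ are incomparable under inclusion and $p_{I\cup J}+p_{I\cap J}=p_I+p_J$, then $I\cup J$ and $I\cap J$ are called left tight, and $I$ and $J$ are called right tight. A bundle is tight if it is left tight or right tight. A submodular auction is degenerate if at least one bundle is tight. For $0\le k\le n$ let $\mathcal{I}_{k,n}=\{I\subseteq[n]\mid 1\le\#I\le k\}\cup\{\emptyset,[n]\}$. A price schedule is critical with respect to $\mathcal{I}_{k,n}$ if (for all $I\subseteq[n]$) $\mathrm{vol}_nD_I>0$ holds exactly when $I\in\mathcal{I}_{k,n}$, and $\delta_n(I)=0$ for all $I\in\mathcal{I}_{k,n}\setminus\{\emptyset\}$. For each $k\in[n]$ there is at most one normalized submodular price schedule critical with respect to $\mathcal{I}_{k,n}$, and for $k=1$ a symmetric one exists. The SJA price schedule is the normalized, submodular, symmetric price schedule that is critical with respect to $\mathcal{I}_{k,n}$ for the maximal $k\in[n]$ for which such a schedule exists; SJA is the corresponding auction.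
   Formalization: Adds the hypothesis that some nonempty I has vol_n D_I > 0 (the auction sells something with positive probability); without it the claim fails, e.g. n=1, q_{1}=2, or n=2, q_{1}=q_{2}=q_{12}=2. *)

theory Defs
  imports "HOL-Analysis.Analysis"
begin

text \<open>A family of prices indexed by the subsets of \<open>{1..n}\<close> is a function on sets that is
  \<open>undefined\<close> outside \<open>Pow {1..n}\<close>, so that equality of functions is equality of families.\<close>

definition price_schedule :: "nat \<Rightarrow> (nat set \<Rightarrow> real) \<Rightarrow> bool" where
  "price_schedule n p \<longleftrightarrow> p \<in> extensional (Pow {1..n}) \<and> p {} = 0"

text \<open>Points of the cube \<open>[0,1]^I\<close> are functions that are \<open>undefined\<close> outside \<open>I\<close>, as in the
  space of the product measure below.\<close>

definition region :: "nat \<Rightarrow> (nat set \<Rightarrow> real) \<Rightarrow> nat set \<Rightarrow> (nat \<Rightarrow> real) set" where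
  "region n p I = {x \<in> {1..n} \<rightarrow>\<^sub>E {0..1}.
     \<forall>J\<subseteq>{1..n}. (\<Sum>i\<in>I. x i) - p I \<ge> (\<Sum>j\<in>J. x j) - p J}"

definition proj :: "nat set \<Rightarrow> (nat \<Rightarrow> real) set \<Rightarrow> (nat \<Rightarrow> real) set" where
  "proj I S = (\<lambda>x. restrict x I) ` S"

text \<open>For \<open>I = {}\<close> the product measure is the unit mass on a one-point space, so that a point has
  volume 1 and the empty set has volume 0.\<close>

definition vol :: "nat set \<Rightarrow> (nat \<Rightarrow> real) set \<Rightarrow> real" where
  "vol I S = measure (\<Pi>\<^sub>M i\<in>I. lborel) S"

definition delta :: "nat \<Rightarrow> (nat set \<Rightarrow> real) \<Rightarrow> nat set \<Rightarrow> real" where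
  "delta n p I = vol I (proj I (region n p I))
     - 1 / (real n + 1) * (\<Sum>i\<in>I. vol (I - {i}) (proj (I - {i}) (region n p I)))"

definition submodular :: "nat \<Rightarrow> (nat set \<Rightarrow> real) \<Rightarrow> bool" where
  "submodular n p \<longleftrightarrow> (\<forall>I\<subseteq>{1..n}. \<forall>J\<subseteq>{1..n}. p (I \<union> J) + p (I \<inter> J) \<le> p I + p J)"

definition symmetric :: "nat \<Rightarrow> (nat set \<Rightarrow> real) \<Rightarrow> bool" where
  "symmetric n p \<longleftrightarrow> (\<forall>I\<subseteq>{1..n}. \<forall>J\<subseteq>{1..n}. card I = card J \<longrightarrow> p I = p J)"

definition normalized :: "nat \<Rightarrow> (nat set \<Rightarrow> real) \<Rightarrow> bool" where
  "normalized n p \<longleftrightarrow> (\<forall>I\<subseteq>{1..n}. vol {1..n} (region n p I) = 0 \<and> I \<noteq> {1..n} \<longrightarrow>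
     p I = Min (p ` {J. J \<subseteq> {1..n} \<and> I \<subset> J}))"

definition tight_pair :: "nat \<Rightarrow> (nat set \<Rightarrow> real) \<Rightarrow> nat set \<Rightarrow> nat set \<Rightarrow> bool" where
  "tight_pair n p I J \<longleftrightarrow> I \<subseteq> {1..n} \<and> J \<subseteq> {1..n} \<and> \<not> I \<subseteq> J \<and> \<not> J \<subseteq> I \<and>
     p (I \<union> J) + p (I \<inter> J) = p I + p J"

definition left_tight :: "nat \<Rightarrow> (nat set \<Rightarrow> real) \<Rightarrow> nat set \<Rightarrow> bool" where
  "left_tight n p K \<longleftrightarrow> (\<exists>I J. tight_pair n p I J \<and> (K = I \<union> J \<or> K = I \<inter> J))"

definition right_tight :: "nat \<Rightarrow> (nat set \<Rightarrow> real) \<Rightarrow> nat set \<Rightarrow> bool" where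
  "right_tight n p K \<longleftrightarrow> (\<exists>I J. tight_pair n p I J \<and> (K = I \<or> K = J))"

definition tight :: "nat \<Rightarrow> (nat set \<Rightarrow> real) \<Rightarrow> nat set \<Rightarrow> bool" where
  "tight n p K \<longleftrightarrow> left_tight n p K \<or> right_tight n p K"

definition degenerate :: "nat \<Rightarrow> (nat set \<Rightarrow> real) \<Rightarrow> bool" where
  "degenerate n p \<longleftrightarrow> (\<exists>K\<subseteq>{1..n}. tight n p K)"

definition bundles :: "nat \<Rightarrow> nat \<Rightarrow> nat set set" where
  "bundles k n = {I. I \<subseteq> {1..n} \<and> 1 \<le> card I \<and> card I \<le> k} \<union> {{}, {1..n}}"

definition critical :: "nat \<Rightarrow> nat set set \<Rightarrow> (nat set \<Rightarrow> real) \<Rightarrow> bool" where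
  "critical n \<I> p \<longleftrightarrow>
     (\<forall>I\<subseteq>{1..n}. vol {1..n} (region n p I) > 0 \<longleftrightarrow> I \<in> \<I>) \<and>
     (\<forall>I\<in>\<I> - {{}}. delta n p I = 0)"

definition sja_candidates :: "nat \<Rightarrow> nat \<Rightarrow> (nat set \<Rightarrow> real) set" where
  "sja_candidates n k = {p. price_schedule n p \<and> normalized n p \<and> submodular n p \<and>
     symmetric n p \<and> critical n (bundles k n) p}"

definition SJA :: "nat \<Rightarrow> nat set \<Rightarrow> real" where
  "SJA n = (THE p. p \<in> sja_candidates n (Max {k \<in> {1..n}. sja_candidates n k \<noteq> {}}))"

end

theory Submission imports Defs begin

text \<open>For a bundle \<open>I\<close> the body \<open>D_I\<close>, projected to the coordinates in \<open>I\<close>, is cut out by the prices of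
  the subsets of \<open>I\<close> alone, because \<open>0\<close> is always a best choice for the other coordinates when prices
  are submodular and monotone. So \<open>\<delta>(I)\<close> is a functional \<open>excess\<close> of the prices on \<open>Pow I\<close>:
  the volume of a body \<open>face I p {}\<close> minus \<open>1/(n+1)\<close> times the volumes of its facets \<open>face I p {i}\<close>
  on the sides \<open>x_i = 1\<close> of the cube.

  The heart of the matter is what happens to the excess of a bundle \<open>N\<close> when its own price \<open>r N\<close> is
  lowered to \<open>t\<close> and all prices of smaller bundles are kept. Every point of the enlarged body has, at
  the old prices, a favourite bundle \<open>J \<subseteq> N\<close>. By submodularity the points with favourite \<open>J\<close> form a
  product of the body of \<open>J\<close> and a set \<open>head N r t J\<close> in the coordinates \<open>N - J\<close>, and the same
  splitting works on every facet, where marginal prices at most \<open>1\<close> ensure that the favourite bundle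
  may be taken to contain the coordinates that equal \<open>1\<close>. Summing up (\<open>excess_decomposition\<close>),
  the new excess of \<open>N\<close> is the sum over \<open>J \<subseteq> N\<close> of the old excess of \<open>J\<close> times the volume of
  \<open>head N r t J\<close>. If the proper nonempty subsets have excess \<open>0\<close>, only \<open>J = N\<close> and \<open>J = {}\<close>
  survive, and the second term is positive: the excess strictly decreases in the price
  (\<open>excess_strictly_decreasing\<close>, \<open>delta_less_if_price_greater\<close>). Hence critical prices are
  determined one bundle size after the other, which makes SJA well defined (\<open>sja_candidate_unique\<close>).

  It remains to recognise \<open>q\<close> as a candidate with the largest possible \<open>k\<close>. Symmetry and
  nondegeneracy make submodularity strict, so that a normalized price schedule can only have
  null regions at bundles of size \<open>n - 1\<close>, priced like the full bundle (\<open>null_region_bundle\<close>).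
  If there are none, \<open>q\<close> is a candidate for \<open>k = n\<close>. Otherwise \<open>q\<close> is a candidate for
  \<open>k = n - 2\<close>, and a candidate \<open>r\<close> for \<open>k = n\<close> or, equivalently, \<open>k = n - 1\<close> is impossible: \<open>r\<close> would
  agree with \<open>q\<close> up to size \<open>n - 2\<close>; \<open>\<delta> \<ge> 0\<close> at size \<open>n - 1\<close> puts the prices of \<open>q\<close> there
  at or below those of \<open>r\<close>; so the full bundle is strictly cheaper under \<open>q\<close>, and its excess
  cannot vanish for both (\<open>no_full_candidate\<close>). When \<open>n \<le> 2\<close>, no
  \<open>k\<close> lies between \<open>1\<close> and \<open>n - 2\<close>, and null regions at size \<open>n - 1\<close> are excluded by direct
  computation (\<open>uniform_single_delta\<close>, \<open>no_uniform_pair_prices\<close>).\<close>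

section \<open>Volumes in finite products of the real line\<close>

abbreviation leb :: "nat set \<Rightarrow> (nat \<Rightarrow> real) measure" where
  "leb A \<equiv> \<Pi>\<^sub>M i\<in>A. lborel"

lemma lborel_family: "product_sigma_finite (\<lambda>_::nat. lborel :: real measure)"
  by unfold_locales

lemma space_leb: "space (leb A) = A \<rightarrow>\<^sub>E UNIV"
  by (simp add: space_PiM)

lemma cube_sets: "finite A \<Longrightarrow> (A \<rightarrow>\<^sub>E {0..1}) \<in> sets (leb A)"
  by (intro sets_PiM_I_finite) auto

lemma emeasure_box:
  assumes "finite A" "\<And>i. i \<in> A \<Longrightarrow> a i \<le> b i"
  shows "emeasure (leb A) (\<Pi>\<^sub>E i\<in>A. {a i..b i}) = ennreal (\<Prod>i\<in>A. b i - a i)"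
proof -
  interpret product_sigma_finite "\<lambda>_::nat. lborel :: real measure" by (rule lborel_family)
  show ?thesis using assms by (subst emeasure_PiM) (auto simp: prod_ennreal)
qed

lemma vol_box:
  assumes "finite A" "\<And>i. i \<in> A \<Longrightarrow> a i \<le> b i"
  shows "vol A (\<Pi>\<^sub>E i\<in>A. {a i..b i}) = (\<Prod>i\<in>A. b i - a i)"
  unfolding vol_def measure_def using emeasure_box[OF assms] assms by (simp add: prod_nonneg)

lemma cube_fmeasurable:
  assumes "finite A" "S \<subseteq> A \<rightarrow>\<^sub>E {0..1}" "S \<in> sets (leb A)"
  shows "S \<in> fmeasurable (leb A)"
proof (rule fmeasurableI2[OF _ assms(2,3)])
  have "emeasure (leb A) (A \<rightarrow>\<^sub>E {0..1}) = ennreal (\<Prod>i\<in>A. 1 - 0)"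
    by (rule emeasure_box) (use assms in auto)
  then show "(A \<rightarrow>\<^sub>E {0..1}) \<in> fmeasurable (leb A)"
    using cube_sets[OF assms(1)] by (intro fmeasurableI) auto
qed

text \<open>Fubini in the direction of one coordinate; the main source of null sets below is the special case
  of a hyperplane.\<close>

lemma emeasure_leb_zero_by_lines:
  assumes fin: "finite A" and i: "i \<in> A" and S: "S \<in> sets (leb A)"
    and line: "\<And>x. countable {y. x(i := y) \<in> S}"
  shows "emeasure (leb A) S = 0"
proof -
  interpret product_sigma_finite "\<lambda>_::nat. lborel :: real measure" by (rule lborel_family)
  define B where "B = A - {i}"
  have A: "A = insert i B" "i \<notin> B" "finite B" using i fin by (auto simp: B_def)
  have ms[measurable]: "S \<in> sets (leb (insert i B))" using S A by simp
  have "emeasure (leb A) S = (\<integral>\<^sup>+ x. indicator S x \<partial>leb (insert i B))"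
    using S A by simp
  also have "\<dots> = (\<integral>\<^sup>+ x. (\<integral>\<^sup>+ y. indicator S (x(i := y)) \<partial>lborel) \<partial>leb B)"
    by (rule product_nn_integral_insert) (use A in auto)
  also have "\<dots> = (\<integral>\<^sup>+ x. 0 \<partial>leb B)"
  proof (rule nn_integral_cong)
    fix x
    have "(\<integral>\<^sup>+ y. indicator S (x(i := y)) \<partial>lborel) = (\<integral>\<^sup>+ y. indicator {y. x(i := y) \<in> S} y \<partial>lborel)"
      by (rule nn_integral_cong) (auto simp: indicator_def)
    also have "\<dots> = emeasure lborel {y. x(i := y) \<in> S}"
      by (rule nn_integral_indicator[OF null_setsD2[OF countable_imp_null_set_lborel[OF line]]])
    also have "\<dots> = 0" by (rule null_setsD1[OF countable_imp_null_set_lborel[OF line]])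
    finally show "(\<integral>\<^sup>+ y. indicator S (x(i := y)) \<partial>lborel) = 0" .
  qed
  finally show ?thesis by simp
qed

lemma hyperplane_sets:
  assumes "finite A"
  shows "{x \<in> space (leb A). (\<Sum>j\<in>A. a j * x j) = c} \<in> sets (leb A)"
  using assms by measurable

lemma emeasure_hyperplane:
  assumes fin: "finite A" and i: "i \<in> A" "a i \<noteq> 0"
  shows "emeasure (leb A) {x \<in> space (leb A). (\<Sum>j\<in>A. a j * x j) = c} = 0"
proof (rule emeasure_leb_zero_by_lines[OF fin i(1) hyperplane_sets[OF fin]])
  fix x :: "nat \<Rightarrow> real"
  have "(\<Sum>j\<in>A. a j * (x(i := y)) j) = a i * y + (\<Sum>j\<in>A-{i}. a j * x j)" for y
    using fin i by (subst sum.remove[of _ i]) (auto intro!: sum.cong)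
  then have "{y. x(i := y) \<in> {x \<in> space (leb A). (\<Sum>j\<in>A. a j * x j) = c}}
     \<subseteq> {(c - (\<Sum>j\<in>A-{i}. a j * x j)) / a i}"
    using i by (auto simp: field_simps)
  then show "countable {y. x(i := y) \<in> {x \<in> space (leb A). (\<Sum>j\<in>A. a j * x j) = c}}"
    by (rule countable_subset) simp
qed

lemma vol_subset_hyperplane:
  assumes "finite A" "i \<in> A" "a i \<noteq> 0" "S \<subseteq> {x \<in> space (leb A). (\<Sum>j\<in>A. a j * x j) = c}"
  shows "vol A S = 0"
proof -
  have "emeasure (leb A) S \<le> emeasure (leb A) {x \<in> space (leb A). (\<Sum>j\<in>A. a j * x j) = c}"
    by (rule emeasure_mono[OF assms(4) hyperplane_sets[OF assms(1)]])
  then show ?thesis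
    using emeasure_hyperplane[of A i a c, OF assms(1-3)] by (simp add: vol_def measure_def)
qed

lemma vol_subset_coordinate_hyperplane:
  assumes "finite A" "i \<in> A" "S \<subseteq> {x \<in> A \<rightarrow>\<^sub>E UNIV. x i = c}"
  shows "vol A S = 0"
  by (rule vol_subset_hyperplane[of A i "\<lambda>j. if j = i then 1 else 0" _ c])
     (use assms in \<open>auto simp: space_leb if_distrib if_distribR sum.delta cong: if_cong\<close>)

text \<open>Volumes of products, with the factors living on complementary sets of coordinates.\<close>

lemma vol_product:
  assumes fin: "finite A" "finite B" and disj: "A \<inter> B = {}"
    and S: "S \<in> sets (leb A)" and T: "T \<in> sets (leb B)"
  defines "X \<equiv> {x \<in> space (leb (A \<union> B)). restrict x A \<in> S \<and> restrict x B \<in> T}"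
  shows "X \<in> sets (leb (A \<union> B))" and "vol (A \<union> B) X = vol A S * vol B T"
proof -
  let ?X = X
  interpret product_sigma_finite "\<lambda>_::nat. lborel :: real measure" by (rule lborel_family)
  interpret FA: finite_product_sigma_finite "\<lambda>_::nat. lborel :: real measure" A by standard (rule fin)
  interpret FB: finite_product_sigma_finite "\<lambda>_::nat. lborel :: real measure" B by standard (rule fin)
  have m1: "(\<lambda>x. restrict x A) \<in> leb (A \<union> B) \<rightarrow>\<^sub>M leb A"
    and m2: "(\<lambda>x. restrict x B) \<in> leb (A \<union> B) \<rightarrow>\<^sub>M leb B"
    by (auto intro!: measurable_restrict_subset)
  have X_eq: "?X = ((\<lambda>x. restrict x A) -` S \<inter> space (leb (A \<union> B))) \<inter> ((\<lambda>x. restrict x B) -` T \<inter> space (leb (A \<union> B)))"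
    unfolding X_def by auto
  show X: "?X \<in> sets (leb (A \<union> B))" unfolding X_eq
    using measurable_sets[OF m1 S] measurable_sets[OF m2 T] by auto
  have "emeasure (leb (A \<union> B)) ?X = emeasure (distr (leb A \<Otimes>\<^sub>M leb B) (leb (A \<union> B)) (merge A B)) ?X"
    by (subst distr_merge[OF disj fin]) simp
  also have "\<dots> = emeasure (leb A \<Otimes>\<^sub>M leb B) (merge A B -` ?X \<inter> space (leb A \<Otimes>\<^sub>M leb B))"
    by (rule emeasure_distr[OF measurable_merge X])
  also have "merge A B -` ?X \<inter> space (leb A \<Otimes>\<^sub>M leb B) = S \<times> T"
  proof -
    have SA: "x \<in> A \<rightarrow>\<^sub>E UNIV" if "x \<in> S" for x
      using that sets.sets_into_space[OF S] by (auto simp: space_leb)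
    have TB: "y \<in> B \<rightarrow>\<^sub>E UNIV" if "y \<in> T" for y
      using that sets.sets_into_space[OF T] by (auto simp: space_leb)
    have "merge A B (x, y) \<in> X \<longleftrightarrow> x \<in> S \<and> y \<in> T"
      if "x \<in> A \<rightarrow>\<^sub>E UNIV" "y \<in> B \<rightarrow>\<^sub>E UNIV" for x y
    proof -
      have "restrict (merge A B (x, y)) A = x" "restrict (merge A B (x, y)) B = y"
        using that disj by (auto simp: restrict_merge PiE_restrict)
      moreover have "merge A B (x, y) \<in> space (leb (A \<union> B))"
        by (auto simp: space_leb merge_def PiE_iff extensional_def)
      ultimately show ?thesis unfolding X_def by simp
    qed
    moreover have "x \<in> A \<rightarrow>\<^sub>E UNIV \<and> y \<in> B \<rightarrow>\<^sub>E UNIV" if "x \<in> S" "y \<in> T" for x y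
      using SA TB that by blast
    ultimately show ?thesis
      unfolding space_pair_measure space_leb by blast
  qed
  also have "emeasure (leb A \<Otimes>\<^sub>M leb B) (S \<times> T) = emeasure (leb A) S * emeasure (leb B) T"
    by (rule FB.emeasure_pair_measure_Times[OF S T])
  finally show "vol (A \<union> B) ?X = vol A S * vol B T"
    by (simp add: vol_def measure_def enn2real_mult)
qed

lemma vol_pos_if_box:
  assumes fin: "finite A" and S: "S \<in> fmeasurable (leb A)"
    and sub: "(\<Pi>\<^sub>E i\<in>A. {a i..b i}) \<subseteq> S" and ab: "\<And>i. i \<in> A \<Longrightarrow> a i < b i"
  shows "0 < vol A S"
proof -
  have "0 < (\<Prod>i\<in>A. b i - a i)" by (rule prod_pos) (use ab in auto)
  also have "\<dots> = vol A (\<Pi>\<^sub>E i\<in>A. {a i..b i})"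
    by (rule vol_box[symmetric, OF fin]) (use ab in \<open>auto intro: less_imp_le\<close>)
  also have "\<dots> \<le> vol A S"
    unfolding vol_def
    by (rule measure_mono_fmeasurable[OF sub _ S]) (intro sets_PiM_I_finite fin, auto)
  finally show ?thesis .
qed

lemma vol_point: "vol {} {\<lambda>_. undefined} = 1"
  using vol_box[of "{}" "\<lambda>_. 0" "\<lambda>_. 1"] by simp

lemma vol_cube_le_1:
  assumes "finite A" "S \<subseteq> A \<rightarrow>\<^sub>E {0..1}"
  shows "vol A S \<le> 1"
proof -
  have "(A \<rightarrow>\<^sub>E {0..1::real}) \<in> fmeasurable (leb A)"
    by (rule cube_fmeasurable) (use assms cube_sets in auto)
  moreover have "vol A (A \<rightarrow>\<^sub>E {0..1}) = 1"
    using vol_box[of A "\<lambda>_. 0" "\<lambda>_. 1"] assms by simp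
  ultimately show ?thesis
    using assms unfolding vol_def
    by (cases "S \<in> sets (leb A)") (auto dest: measure_mono_fmeasurable simp: measure_notin_sets)
qed

lemma vol_nonneg: "0 \<le> vol A S"
  by (simp add: vol_def)

text \<open>The area between two graphs over \<open>[a, b]\<close>, where \<open>U\<close> is an antiderivative of the height. This
  serves for the two triangles that occur in the case of two items.\<close>

lemma vol_between_graphs:
  fixes l u U :: "real \<Rightarrow> real"
  assumes ij: "i \<noteq> j" and ab: "a \<le> b"
    and lu: "\<And>x. a \<le> x \<Longrightarrow> x \<le> b \<Longrightarrow> l x \<le> u x"
    and meas[measurable]: "l \<in> borel_measurable borel" "u \<in> borel_measurable borel"
    and U: "\<And>x. a \<le> x \<Longrightarrow> x \<le> b \<Longrightarrow> (U has_real_derivative u x - l x) (at x)"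
  defines "S \<equiv> {x \<in> space (leb {j, i}). a \<le> x i \<and> x i \<le> b \<and> l (x i) \<le> x j \<and> x j \<le> u (x i)}"
  shows "S \<in> fmeasurable (leb {j, i})" and "vol {j, i} S = U b - U a"
proof -
  interpret product_sigma_finite "\<lambda>_::nat. lborel :: real measure" by (rule lborel_family)
  have xi: "(\<lambda>x. x i) \<in> borel_measurable (leb {j, i})"
    using measurable_component_singleton[of i "{j, i}" "\<lambda>_. lborel :: real measure"] by simp
  have xj: "(\<lambda>x. x j) \<in> borel_measurable (leb {j, i})"
    using measurable_component_singleton[of j "{j, i}" "\<lambda>_. lborel :: real measure"] by simp
  have S: "S \<in> sets (leb {j, i})" unfolding S_def 
    by (intro sets.sets_Collect_conj borel_measurable_le borel_measurable_const xi xj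
        measurable_compose[OF xi meas(1)] measurable_compose[OF xi meas(2)])
  have "emeasure (leb {j, i}) S = (\<integral>\<^sup>+ x. indicator S x \<partial>leb {j, i})"
    using S by simp
  also have "\<dots> = (\<integral>\<^sup>+ x. (\<integral>\<^sup>+ y. indicator S (x(j := y)) \<partial>lborel) \<partial>leb {i})"
    by (rule product_nn_integral_insert) (use ij S in auto)
  also have "\<dots> = (\<integral>\<^sup>+ x. ennreal (u (x i) - l (x i)) * indicator {a..b} (x i) \<partial>leb {i})"
  proof (rule nn_integral_cong)
    fix x :: "nat \<Rightarrow> real" assume x: "x \<in> space (leb {i})"
    show "(\<integral>\<^sup>+ y. indicator S (x(j := y)) \<partial>lborel) = ennreal (u (x i) - l (x i)) * indicator {a..b} (x i)"
    proof (cases "x i \<in> {a..b}")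
      case True
      have "x(j := y) \<in> S \<longleftrightarrow> y \<in> {l (x i)..u (x i)}" for y
        using x ij True by (auto simp: S_def space_leb PiE_iff extensional_def)
      then have "(\<integral>\<^sup>+ y. indicator S (x(j := y)) \<partial>lborel) = (\<integral>\<^sup>+ y. indicator {l (x i)..u (x i)} y \<partial>lborel)"
        by (intro nn_integral_cong) (auto simp: indicator_def)
      also have "\<dots> = ennreal (u (x i) - l (x i))"
        using lu[of "x i"] True by simp
      finally show ?thesis using True by simp
    next
      case False
      then have "x(j := y) \<notin> S" for y using ij by (auto simp: S_def)
      then show ?thesis using False by simp
    qed
  qed
  also have "\<dots> = (\<integral>\<^sup>+ x. ennreal (u x - l x) * indicator {a..b} x \<partial>lborel)"
    by (rule product_nn_integral_singleton) measurable
  also have "\<dots> = ennreal (U b - U a)"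
    by (rule nn_integral_FTC_Icc) (use U lu ab in \<open>auto intro: has_field_derivative_at_within\<close>)
  finally have em: "emeasure (leb {j, i}) S = ennreal (U b - U a)" .
  then show "S \<in> fmeasurable (leb {j, i})" using S by (intro fmeasurableI) auto
  have "U a \<le> U b"
    by (rule DERIV_nonneg_imp_nondecreasing[OF ab]) (use U lu in \<open>force\<close>)
  then show "vol {j, i} S = U b - U a" using em by (simp add: vol_def measure_def)
qed

section \<open>Bodies, facets and excess\<close>

text \<open>Facets of a body are described by the free coordinates; the coordinates in \<open>F\<close> are filled with the
  value \<open>1\<close>. The case \<open>F = {}\<close> is the body itself, so that bodies and facets can be treated at once.\<close>

definition fill :: "nat set \<Rightarrow> (nat \<Rightarrow> real) \<Rightarrow> nat \<Rightarrow> real" where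
  "fill F x = (\<lambda>i. if i \<in> F then 1 else x i)"

lemma fill_empty [simp]: "fill {} x = x"
  by (simp add: fill_def)

definition face :: "nat set \<Rightarrow> (nat set \<Rightarrow> real) \<Rightarrow> nat set \<Rightarrow> (nat \<Rightarrow> real) set" where
  "face N p F = {x \<in> (N - F) \<rightarrow>\<^sub>E {0..1}.
     \<forall>J\<subseteq>N. sum (fill F x) J - p J \<le> sum (fill F x) N - p N}"

definition excess :: "real \<Rightarrow> nat set \<Rightarrow> (nat set \<Rightarrow> real) \<Rightarrow> real" where
  "excess c N p = vol N (face N p {}) - c * (\<Sum>i\<in>N. vol (N - {i}) (face N p {i}))"

text \<open>A point whose favourite bundle at prices \<open>r\<close> is \<open>J\<close> has coordinates outside \<open>J\<close> that make no
  extra items \<open>B\<close> worth their marginal price. The last condition says that the full bundle becomes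
  at least as good as \<open>J\<close> once its price drops to \<open>t\<close>.\<close>

definition head :: "nat set \<Rightarrow> (nat set \<Rightarrow> real) \<Rightarrow> real \<Rightarrow> nat set \<Rightarrow> (nat \<Rightarrow> real) set" where
  "head N r t J = {y \<in> (N - J) \<rightarrow>\<^sub>E {0..1}.
     (\<forall>B\<subseteq>N - J. sum y B \<le> r (J \<union> B) - r J) \<and> t - r J \<le> sum y (N - J)}"

lemma sum_fill_measurable:
  assumes "J \<subseteq> N"
  shows "(\<lambda>x. sum (fill F x) J) \<in> borel_measurable (leb (N - F))"
proof (rule borel_measurable_sum)
  fix i assume i: "i \<in> J"
  show "(\<lambda>x. fill F x i) \<in> borel_measurable (leb (N - F))"
  proof (cases "i \<in> F")
    case False
    with i assms have "i \<in> N - F" by auto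
    then have "(\<lambda>x. x i) \<in> leb (N - F) \<rightarrow>\<^sub>M lborel" by (rule measurable_component_singleton)
    with False show ?thesis by (simp add: fill_def)
  qed (simp add: fill_def)
qed

lemma face_sets:
  assumes fin: "finite N"
  shows "face N p F \<in> sets (leb (N - F))"
proof -
  have "face N p F = ((N - F) \<rightarrow>\<^sub>E {0..1}) \<inter>
     {x \<in> space (leb (N - F)). \<forall>J\<in>Pow N. sum (fill F x) J - p J \<le> sum (fill F x) N - p N}"
    by (auto simp: face_def space_leb PiE_def)
  moreover have "{x \<in> space (leb (N - F)). \<forall>J\<in>Pow N. sum (fill F x) J - p J \<le> sum (fill F x) N - p N}
     \<in> sets (leb (N - F))"
  proof (rule sets.sets_Collect_finite_All')
    fix J assume "J \<in> Pow N"
    then have [measurable]: "(\<lambda>x. sum (fill F x) J) \<in> borel_measurable (leb (N - F))"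
      "(\<lambda>x. sum (fill F x) N) \<in> borel_measurable (leb (N - F))"
      by (auto intro: sum_fill_measurable)
    show "{x \<in> space (leb (N - F)). sum (fill F x) J - p J \<le> sum (fill F x) N - p N} \<in> sets (leb (N - F))"
      by measurable
  qed (use fin in auto)
  moreover have "((N - F) \<rightarrow>\<^sub>E {0..1}) \<in> sets (leb (N - F))"
    by (rule cube_sets) (use fin in auto)
  ultimately show ?thesis by auto
qed

lemma head_sets:
  assumes fin: "finite N"
  shows "head N r t J \<in> sets (leb (N - J))"
proof -
  have m: "(\<lambda>x. sum x B) \<in> borel_measurable (leb (N - J))" if "B \<subseteq> N - J" for B
    using sum_fill_measurable[of B "N - J" "{}"] that by simp
  have "head N r t J = ((N - J) \<rightarrow>\<^sub>E {0..1}) \<inter>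
     ({x \<in> space (leb (N - J)). \<forall>B\<in>Pow (N - J). sum x B \<le> r (J \<union> B) - r J} \<inter>
      {x \<in> space (leb (N - J)). t - r J \<le> sum x (N - J)})"
    by (auto simp: head_def space_leb PiE_def)
  moreover have "{x \<in> space (leb (N - J)). \<forall>B\<in>Pow (N - J). sum x B \<le> r (J \<union> B) - r J} \<in> sets (leb (N - J))"
  proof (rule sets.sets_Collect_finite_All')
    fix B assume "B \<in> Pow (N - J)"
    with m have [measurable]: "(\<lambda>x. sum x B) \<in> borel_measurable (leb (N - J))" by auto
    show "{x \<in> space (leb (N - J)). sum x B \<le> r (J \<union> B) - r J} \<in> sets (leb (N - J))" by measurable
  qed (use fin in auto)
  moreover have "{x \<in> space (leb (N - J)). t - r J \<le> sum x (N - J)} \<in> sets (leb (N - J))"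
    using m[of "N - J"] by measurable
  moreover have "((N - J) \<rightarrow>\<^sub>E {0..1}) \<in> sets (leb (N - J))"
    by (rule cube_sets) (use fin in auto)
  ultimately show ?thesis by auto
qed

section \<open>Splitting a body by the favourite bundle\<close>

definition submodular_on :: "nat set \<Rightarrow> (nat set \<Rightarrow> real) \<Rightarrow> bool" where
  "submodular_on N r \<longleftrightarrow> (\<forall>I\<subseteq>N. \<forall>J\<subseteq>N. r (I \<union> J) + r (I \<inter> J) \<le> r I + r J)"

lemma submodular_onD:
  "submodular_on N r \<Longrightarrow> I \<subseteq> N \<Longrightarrow> J \<subseteq> N \<Longrightarrow> r (I \<union> J) + r (I \<inter> J) \<le> r I + r J"
  by (simp add: submodular_on_def)

lemma marginal_price_le:
  fixes r :: "nat set \<Rightarrow> real" and u :: real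
  assumes sub: "submodular_on N r" and r: "r {} = 0" "\<And>i. i \<in> N \<Longrightarrow> r {i} \<le> u"
    and fin: "finite F" and "F \<subseteq> N" "J \<subseteq> N" "F \<inter> J = {}"
  shows "r (J \<union> F) \<le> r J + card F * u"
  using fin assms(5-)
proof (induction F rule: finite_induct)
  case (insert i F)
  have "r ((J \<union> F) \<union> {i}) + r ((J \<union> F) \<inter> {i}) \<le> r (J \<union> F) + r {i}"
    by (rule submodular_onD[OF sub]) (use insert.prems in auto)
  moreover have "(J \<union> F) \<inter> {i} = {}" "(J \<union> F) \<union> {i} = J \<union> insert i F" using insert by auto
  moreover have "r {i} \<le> u" using r(2) insert.prems by auto
  moreover have "r (J \<union> F) \<le> r J + card F * u" using insert by auto
  ultimately show ?case using insert.hyps r(1) by (simp add: algebra_simps)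
qed simp

text \<open>The part of the enlarged body (or facet) of \<open>N\<close> where \<open>J\<close> is a favourite bundle, defined
  as a product; \<open>piece_iff\<close> gives the description by optimality.\<close>

definition piece :: "nat set \<Rightarrow> (nat set \<Rightarrow> real) \<Rightarrow> real \<Rightarrow> nat set \<Rightarrow> nat set \<Rightarrow> (nat \<Rightarrow> real) set" where
  "piece N r t F J = {x \<in> space (leb (N - F)).
     restrict x (J - F) \<in> face J r F \<and> restrict x (N - J) \<in> head N r t J}"

lemma sum_fill_restrict:
  assumes "K \<subseteq> J"
  shows "sum (fill F (restrict x (J - F))) K = sum (fill F x) K"
  using assms by (intro sum.cong) (auto simp: fill_def)

text \<open>Optimality of \<open>J\<close> among all subsets \<open>K\<close> of \<open>N\<close> separates into a condition on the coordinates
  in \<open>J\<close> (compare with \<open>K \<inter> J\<close>) and one on the coordinates outside (compare with \<open>K \<union> J\<close>):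
  submodularity bounds \<open>r (K \<union> J) + r (K \<inter> J)\<close> by \<open>r K + r J\<close>, so the two comparisons add up.\<close>

lemma piece_iff:
  assumes fin: "finite N" and F: "F \<subseteq> J" "J \<subseteq> N" and sub: "submodular_on N r"
    and t: "t \<le> r N"
  shows "x \<in> piece N r t F J \<longleftrightarrow> x \<in> (N - F) \<rightarrow>\<^sub>E {0..1} \<and>
     (\<forall>K\<subseteq>N. sum (fill F x) K - r K \<le> sum (fill F x) J - r J) \<and>
     sum (fill F x) J - r J \<le> sum (fill F x) N - t" (is "_ \<longleftrightarrow> ?R")
proof -
  let ?z = "fill F x"
  have finJ: "finite K" if "K \<subseteq> N" for K using fin that finite_subset by blast
  have outside: "sum (restrict x (N - J)) B = sum ?z B" if "B \<subseteq> N - J" for B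
    using that F by (intro sum.cong) (auto simp: fill_def)
  have split: "sum ?z K = sum ?z (K \<inter> J) + sum ?z (K - J)" if "K \<subseteq> N" for K
    by (subst sum.union_disjoint[symmetric]) (use finJ[OF that] in \<open>auto intro!: sum.cong\<close>)
  have NJ: "N \<inter> J = J" using F by auto
  show ?thesis
  proof
    assume x: "x \<in> piece N r t F J"
    have cube: "x \<in> (N - F) \<rightarrow>\<^sub>E {0..1}"
    proof (rule PiE_I)
      fix i assume i: "i \<in> N - F"
      show "x i \<in> {0..1}"
      proof (cases "i \<in> J")
        case True
        have "restrict x (J - F) \<in> (J - F) \<rightarrow>\<^sub>E {0..1}" using x unfolding piece_def face_def by blast
        from PiE_mem[OF this, of i] have "restrict x (J - F) i \<in> {0..1}" using True i by auto
        with True i show ?thesis by simp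
      next
        case False
        have "restrict x (N - J) \<in> (N - J) \<rightarrow>\<^sub>E {0..1}" using x unfolding piece_def head_def by blast
        from PiE_mem[OF this, of i] have "restrict x (N - J) i \<in> {0..1}" using False i by auto
        with False i show ?thesis by simp
      qed
    next
      fix i assume "i \<notin> N - F"
      then show "x i = undefined" using x by (auto simp: piece_def space_leb PiE_iff extensional_def)
    qed
    have inner: "sum ?z K - r K \<le> sum ?z J - r J" if "K \<subseteq> J" for K
      using x that unfolding piece_def face_def by (auto simp: sum_fill_restrict)
    have h: "\<forall>B\<subseteq>N - J. sum (restrict x (N - J)) B \<le> r (J \<union> B) - r J"
        "t - r J \<le> sum (restrict x (N - J)) (N - J)"
      using x unfolding piece_def head_def by blast+
    have outer: "sum ?z B \<le> r (J \<union> B) - r J" if "B \<subseteq> N - J" for B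
      using h(1) that outside[OF that] by metis
    have top: "t - r J \<le> sum ?z (N - J)"
      using h(2) outside[OF order_refl] by simp
    have "sum ?z K - r K \<le> sum ?z J - r J" if K: "K \<subseteq> N" for K
    proof -
      have "r (K \<union> J) + r (K \<inter> J) \<le> r K + r J" by (rule submodular_onD[OF sub K F(2)])
      moreover have "J \<union> (K - J) = K \<union> J" by auto
      moreover have "sum ?z (K \<inter> J) - r (K \<inter> J) \<le> sum ?z J - r J" by (rule inner) simp
      moreover have "sum ?z (K - J) \<le> r (J \<union> (K - J)) - r J" by (rule outer) (use K in blast)
      ultimately show ?thesis using split[OF K] by simp
    qed
    moreover have "sum ?z J - r J \<le> sum ?z N - t" using top split[of N] NJ by auto
    ultimately show ?R using cube by blast
  next
    assume R: ?R
    then have cube: "x \<in> (N - F) \<rightarrow>\<^sub>E {0..1}" by blast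
    have head1: "sum ?z B \<le> r (J \<union> B) - r J" if B: "B \<subseteq> N - J" for B
    proof -
      have "sum ?z (J \<union> B) = sum ?z J + sum ?z B"
        by (rule sum.union_disjoint) (use B F finJ in \<open>auto intro: finite_subset[OF _ fin]\<close>)
      moreover have "sum ?z (J \<union> B) - r (J \<union> B) \<le> sum ?z J - r J"
      proof -
        have "J \<union> B \<subseteq> N" using B F by blast
        with R show ?thesis by blast
      qed
      ultimately show ?thesis by simp
    qed
    have head2: "t - r J \<le> sum ?z (N - J)" using R split[of N] NJ by auto
    have face1: "sum ?z K - r K \<le> sum ?z J - r J" if "K \<subseteq> J" for K
      using R order_trans[OF that F(2)] by blast
    have "restrict x (J - F) \<in> (J - F) \<rightarrow>\<^sub>E {0..1}" "restrict x (N - J) \<in> (N - J) \<rightarrow>\<^sub>E {0..1}"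
      "x \<in> (N - F) \<rightarrow>\<^sub>E UNIV"
      using cube F by (auto simp: PiE_iff)
    moreover have "\<forall>K\<subseteq>J. sum (fill F (restrict x (J - F))) K - r K \<le> sum (fill F (restrict x (J - F))) J - r J"
      using face1 by (metis order_refl sum_fill_restrict)
    moreover have "\<forall>B\<subseteq>N - J. sum (restrict x (N - J)) B \<le> r (J \<union> B) - r J"
      using head1 outside by metis
    moreover have "t - r J \<le> sum (restrict x (N - J)) (N - J)"
      using head2 outside[OF order_refl] by simp
    ultimately show "x \<in> piece N r t F J"
      unfolding piece_def face_def head_def space_leb by blast
  qed
qed

text \<open>Lowering the price of \<open>N\<close> to \<open>t\<close> enlarges the body of \<open>N\<close>. Its points are sorted by their
  favourite bundle at the old prices; the old body is the piece of \<open>J = N\<close>.\<close>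

lemma face_decomposition:
  assumes fin: "finite N" and F: "F \<subseteq> N" and sub: "submodular_on N r"
    and r: "r {} = 0" "\<And>i. i \<in> N \<Longrightarrow> r {i} \<le> 1" and t: "t \<le> r N"
  shows "face N (r(N := t)) F = (\<Union>J\<in>{J. F \<subseteq> J \<and> J \<subseteq> N}. piece N r t F J)"
proof (intro set_eqI iffI)
  fix x assume x: "x \<in> face N (r(N := t)) F"
  let ?z = "fill F x"
  define u where "u J = sum ?z J - r J" for J
  have finP: "finite (u ` Pow N)" "u ` Pow N \<noteq> {}" using fin by auto
  have "Max (u ` Pow N) \<in> u ` Pow N" by (rule Max_in[OF finP])
  then obtain J0 where "J0 \<in> Pow N" and J0_Max: "Max (u ` Pow N) = u J0" by (rule imageE)
  then have J0: "J0 \<subseteq> N" by blast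
  have best0: "u K \<le> u J0" if "K \<subseteq> N" for K
    unfolding J0_Max[symmetric] by (rule Max_ge[OF finP(1)]) (use that in blast)
  (* Items of value 1 cost at most 1 more, so a favourite bundle stays one when F is added. *)
  define J where "J = J0 \<union> F"
  have J: "F \<subseteq> J" "J \<subseteq> N" using F J0 by (auto simp: J_def)
  have finJ: "finite J0" "finite (F - J0)"
    using finite_subset[OF J0 fin] finite_subset[OF F fin] by simp_all
  have "sum ?z J = sum ?z (J0 \<union> (F - J0))" by (simp add: J_def)
  also have "\<dots> = sum ?z J0 + sum ?z (F - J0)" by (rule sum.union_disjoint) (use finJ in auto)
  also have "sum ?z (F - J0) = card (F - J0)" by (simp add: fill_def)
  finally have "sum ?z J = sum ?z J0 + card (F - J0)" .
  moreover have "r (J0 \<union> (F - J0)) \<le> r J0 + real (card (F - J0)) * 1"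
    by (rule marginal_price_le[OF sub r finJ(2)]) (use J0 F in auto)
  ultimately have "u J0 \<le> u J" by (simp add: u_def J_def)
  then have best: "u K \<le> u J" if "K \<subseteq> N" for K using best0[OF that] by simp
  have "sum ?z J - r J \<le> sum ?z N - t"
  proof (cases "J = N")
    case False
    then have "sum ?z J - (r(N := t)) J \<le> sum ?z N - (r(N := t)) N"
      using x J(2) unfolding face_def by blast
    with False show ?thesis by simp
  qed (use t in simp)
  moreover have "x \<in> (N - F) \<rightarrow>\<^sub>E {0..1}" using x by (simp add: face_def)
  ultimately have "x \<in> piece N r t F J"
    using best unfolding piece_iff[OF fin J sub t] u_def by blast
  then show "x \<in> (\<Union>J\<in>{J. F \<subseteq> J \<and> J \<subseteq> N}. piece N r t F J)" using J by blast
next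
  fix x assume "x \<in> (\<Union>J\<in>{J. F \<subseteq> J \<and> J \<subseteq> N}. piece N r t F J)"
  then obtain J where J: "F \<subseteq> J" "J \<subseteq> N" and x: "x \<in> piece N r t F J" by blast
  have opt: "sum (fill F x) K - r K \<le> sum (fill F x) J - r J" if "K \<subseteq> N" for K
    using x that unfolding piece_iff[OF fin J sub t] by blast
  have top: "sum (fill F x) J - r J \<le> sum (fill F x) N - t"
    using x unfolding piece_iff[OF fin J sub t] by blast
  have "sum (fill F x) K - (r(N := t)) K \<le> sum (fill F x) N - (r(N := t)) N" if "K \<subseteq> N" for K
    using opt[OF that] top by simp
  moreover have "x \<in> (N - F) \<rightarrow>\<^sub>E {0..1}" using x unfolding piece_iff[OF fin J sub t] by blast
  ultimately show "x \<in> face N (r(N := t)) F" by (simp add: face_def)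
qed

text \<open>A point with two favourite bundles lies on the hyperplane where both have the same utility. Since
  the bundles agree on \<open>F\<close>, they differ in a free coordinate, and the hyperplane is proper.\<close>

lemma piece_overlap_null:
  assumes fin: "finite N" and JK: "F \<subseteq> J" "J \<subseteq> N" "F \<subseteq> K" "K \<subseteq> N" "J \<noteq> K"
    and sub: "submodular_on N r" and t: "t \<le> r N"
  shows "AE x in leb (N - F). x \<notin> piece N r t F J \<or> x \<notin> piece N r t F K"
proof -
  obtain i where i: "i \<in> N - F" "(i \<in> J) \<noteq> (i \<in> K)" using JK by blast
  define a :: "nat \<Rightarrow> real" where "a j = of_bool (j \<in> J) - of_bool (j \<in> K)" for j
  have fin': "finite (N - F)" using fin by simp
  define H where "H = {x \<in> space (leb (N - F)). (\<Sum>j\<in>N-F. a j * x j) = r J - r K}"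
  have part: "sum (fill F x) L = card F + (\<Sum>j\<in>N-F. of_bool (j \<in> L) * x j)"
    if L: "F \<subseteq> L" "L \<subseteq> N" for L and x :: "nat \<Rightarrow> real"
  proof -
    have finL: "finite L" "finite F"
      using finite_subset[OF L(2) fin] finite_subset[OF L(1)] by simp_all
    have "sum (fill F x) L = sum (fill F x) F + sum (fill F x) (L - F)"
      using L finL by (metis add.commute sum.subset_diff)
    also have "sum (fill F x) F = card F" by (simp add: fill_def)
    also have "sum (fill F x) (L - F) = (\<Sum>j\<in>L-F. x j)" by (intro sum.cong) (auto simp: fill_def)
    also have "(\<Sum>j\<in>L-F. x j) = (\<Sum>j\<in>N-F. of_bool (j \<in> L) * x j)"
      by (rule sum.mono_neutral_cong_left) (use fin L in auto)
    finally show ?thesis .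
  qed
  have "x \<in> H" if x: "x \<in> piece N r t F J" "x \<in> piece N r t F K" for x
  proof -
    have "sum (fill F x) J - r J = sum (fill F x) K - r K"
      using x(1) x(2) JK unfolding piece_iff[OF fin JK(1,2) sub t] piece_iff[OF fin JK(3,4) sub t]
      by (meson order_antisym)
    then have "(\<Sum>j\<in>N-F. a j * x j) = r J - r K"
      unfolding part[OF JK(1,2)] part[OF JK(3,4)] a_def
      by (simp add: left_diff_distrib sum_subtractf)
    moreover have "x \<in> space (leb (N - F))" using x by (simp add: piece_def)
    ultimately show ?thesis by (simp add: H_def)
  qed
  moreover have "H \<in> null_sets (leb (N - F))"
    unfolding H_def
    by (intro null_setsI emeasure_hyperplane[OF fin' i(1)] hyperplane_sets[OF fin'])
       (use i in \<open>auto simp: a_def\<close>)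
  ultimately show ?thesis
    by (intro AE_I'[of H]) auto
qed

lemma piece_sets_vol:
  assumes fin: "finite N" and J: "F \<subseteq> J" "J \<subseteq> N"
  shows "piece N r t F J \<in> sets (leb (N - F))"
    and "vol (N - F) (piece N r t F J) = vol (J - F) (face J r F) * vol (N - J) (head N r t J)"
proof -
  have un: "(J - F) \<union> (N - J) = N - F" using J by auto
  have finJ: "finite J" using J fin finite_subset by blast
  note P = vol_product[of "J - F" "N - J" "face J r F" "head N r t J", unfolded un,
      folded piece_def, OF _ _ _ face_sets head_sets]
  show "piece N r t F J \<in> sets (leb (N - F))" by (rule P(1)) (use fin finJ in auto)
  show "vol (N - F) (piece N r t F J) = vol (J - F) (face J r F) * vol (N - J) (head N r t J)"
    by (rule P(2)) (use fin finJ in auto)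
qed

lemma vol_face_decomposition:
  assumes fin: "finite N" and F: "F \<subseteq> N" and sub: "submodular_on N r"
    and r: "r {} = 0" "\<And>i. i \<in> N \<Longrightarrow> r {i} \<le> 1" and t: "t \<le> r N"
  shows "vol (N - F) (face N (r(N := t)) F) =
     (\<Sum>J\<in>{J. F \<subseteq> J \<and> J \<subseteq> N}. vol (J - F) (face J r F) * vol (N - J) (head N r t J))"
proof -
  let ?I = "{J. F \<subseteq> J \<and> J \<subseteq> N}"
  have "vol (N - F) (face N (r(N := t)) F) = measure (leb (N - F)) (\<Union>J\<in>?I. piece N r t F J)"
    by (simp add: vol_def face_decomposition[OF assms])
  also have "\<dots> = (\<Sum>J\<in>?I. measure (leb (N - F)) (piece N r t F J))"
  proof (rule measure_UNION_AE)
    show "finite ?I" using finite_subset[of ?I "Pow N"] fin by auto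
    show "piece N r t F J \<in> fmeasurable (leb (N - F))" if J: "J \<in> ?I" for J
    proof (rule cube_fmeasurable)
      show "piece N r t F J \<subseteq> (N - F) \<rightarrow>\<^sub>E {0..1}" using J piece_iff[OF fin _ _ sub t] by blast
      show "piece N r t F J \<in> sets (leb (N - F))" using J piece_sets_vol(1)[OF fin] by blast
    qed (use fin in simp)
    show "pairwise (\<lambda>i j. AE x in leb (N - F). x \<notin> piece N r t F i \<or> x \<notin> piece N r t F j) ?I"
      using piece_overlap_null[OF fin _ _ _ _ _ sub t] by (auto simp: pairwise_def)
  qed
  also have "\<dots> = (\<Sum>J\<in>?I. vol (J - F) (face J r F) * vol (N - J) (head N r t J))"
    by (rule sum.cong) (use piece_sets_vol(2)[OF fin] in \<open>auto simp: vol_def\<close>)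
  finally show ?thesis .
qed

text \<open>The pieces of the body and of its facets have the same heads, so the decompositions of all
  volumes combine to one of the excess.\<close>

lemma excess_decomposition:
  assumes fin: "finite N" and sub: "submodular_on N r"
    and r: "r {} = 0" "\<And>i. i \<in> N \<Longrightarrow> r {i} \<le> 1" and t: "t \<le> r N"
  shows "excess c N (r(N := t)) = (\<Sum>J\<in>Pow N. excess c J r * vol (N - J) (head N r t J))"
proof -
  let ?h = "\<lambda>J. vol (N - J) (head N r t J)"
  have body: "vol N (face N (r(N := t)) {}) = (\<Sum>J\<in>Pow N. vol J (face J r {}) * ?h J)"
    using vol_face_decomposition[OF fin _ sub r t, of "{}"] by (simp add: Pow_def)
  have facet: "vol (N - {i}) (face N (r(N := t)) {i}) =
      (\<Sum>J\<in>Pow N. if i \<in> J then vol (J - {i}) (face J r {i}) * ?h J else 0)" if "i \<in> N" for i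
  proof -
    have "{J. {i} \<subseteq> J \<and> J \<subseteq> N} = {J \<in> Pow N. i \<in> J}" by auto
    then have "vol (N - {i}) (face N (r(N := t)) {i}) =
        (\<Sum>J\<in>{J \<in> Pow N. i \<in> J}. vol (J - {i}) (face J r {i}) * ?h J)"
      using vol_face_decomposition[OF fin _ sub r t, of "{i}"] that by simp
    also have "\<dots> = (\<Sum>J\<in>Pow N. if i \<in> J then vol (J - {i}) (face J r {i}) * ?h J else 0)"
      by (rule sum.inter_filter) (use fin in simp)
    finally show ?thesis .
  qed
  have "(\<Sum>i\<in>N. vol (N - {i}) (face N (r(N := t)) {i})) =
      (\<Sum>J\<in>Pow N. \<Sum>i\<in>N. if i \<in> J then vol (J - {i}) (face J r {i}) * ?h J else 0)"
    using facet by (simp add: sum.swap[of _ "Pow N" N])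
  also have "\<dots> = (\<Sum>J\<in>Pow N. (\<Sum>i\<in>J. vol (J - {i}) (face J r {i})) * ?h J)"
  proof (rule sum.cong[OF refl])
    fix J assume "J \<in> Pow N"
    then have J_eq: "{i \<in> N. i \<in> J} = J" by auto
    have "(\<Sum>i\<in>N. if i \<in> J then vol (J - {i}) (face J r {i}) * ?h J else 0) =
        (\<Sum>i\<in>{i \<in> N. i \<in> J}. vol (J - {i}) (face J r {i}) * ?h J)"
      by (rule sum.inter_filter[symmetric, OF fin])
    then show "(\<Sum>i\<in>N. if i \<in> J then vol (J - {i}) (face J r {i}) * ?h J else 0) =
        (\<Sum>i\<in>J. vol (J - {i}) (face J r {i})) * ?h J"
      unfolding J_eq by (simp add: sum_distrib_right)
  qed
  finally have facets: "(\<Sum>i\<in>N. vol (N - {i}) (face N (r(N := t)) {i})) =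
      (\<Sum>J\<in>Pow N. (\<Sum>i\<in>J. vol (J - {i}) (face J r {i})) * ?h J)" .
  have "c * (\<Sum>i\<in>N. vol (N - {i}) (face N (r(N := t)) {i})) =
      (\<Sum>J\<in>Pow N. c * (\<Sum>i\<in>J. vol (J - {i}) (face J r {i})) * ?h J)"
    unfolding facets by (subst sum_distrib_left) (simp only: mult.assoc)
  then show ?thesis
    unfolding excess_def body by (simp only: left_diff_distrib sum_subtractf)
qed

section \<open>The excess decreases in the price\<close>

lemma excess_empty: "excess c {} r = 1"
proof -
  have "face {} r {} = {\<lambda>_. undefined}" by (auto simp: face_def)
  then show ?thesis by (simp add: excess_def vol_point)
qed

lemma vol_head_full:
  assumes "t \<le> r N"
  shows "vol (N - N) (head N r t N) = 1"
proof -
  have "head N r t N = {\<lambda>_. undefined}" using assms by (auto simp: head_def)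
  then show ?thesis by (simp add: vol_point)
qed

text \<open>If \<open>J\<close> already costs as much as \<open>N\<close>, any further item is free by monotonicity, and a point that
  does not want a free item has value \<open>0\<close> for it.\<close>

lemma vol_head_top_price:
  assumes fin: "finite N" and J: "J \<subset> N" and eq: "r J = r N"
    and mono: "\<And>I J. I \<subseteq> J \<Longrightarrow> J \<subseteq> N \<Longrightarrow> r I \<le> r J"
  shows "vol (N - J) (head N r t J) = 0"
proof -
  obtain i where i: "i \<in> N - J" using J by blast
  have "y i = 0" if y: "y \<in> head N r t J" for y
  proof -
    have "sum y {i} \<le> r (J \<union> {i}) - r J" using y i unfolding head_def by blast
    moreover have "r (J \<union> {i}) \<le> r N" by (rule mono) (use i J in auto)
    moreover have "y \<in> (N - J) \<rightarrow>\<^sub>E {0..1}" using y unfolding head_def by blast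
    then have "y i \<in> {0..1}" using i by (rule PiE_mem)
    ultimately show ?thesis using eq by simp
  qed
  then have "head N r t J \<subseteq> {y \<in> (N - J) \<rightarrow>\<^sub>E UNIV. y i = 0}"
    by (auto simp: head_def PiE_iff)
  then show ?thesis
    by (rule vol_subset_coordinate_hyperplane[rotated 2]) (use fin i in auto)
qed

text \<open>The marginal prices when the items of \<open>N\<close> are bought in increasing order: a vertex of the
  base polytope of the submodular function \<open>r\<close>.\<close>

definition greedy :: "nat set \<Rightarrow> (nat set \<Rightarrow> real) \<Rightarrow> nat \<Rightarrow> real" where
  "greedy N r j = r {k \<in> N. k \<le> j} - r {k \<in> N. k < j}"

text \<open>Remove the largest element \<open>b\<close> of \<open>B\<close>. By submodularity its marginal price over all smaller
  elements of \<open>N\<close> is at most its marginal price over the rest of \<open>B\<close>.\<close>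

lemma sum_greedy_le:
  assumes fin: "finite B" and B: "B \<subseteq> N" and sub: "submodular_on N r" and r: "r {} = 0"
  shows "sum (greedy N r) B \<le> r B"
  using fin B
proof (induction B rule: finite_linorder_max_induct)
  case (insert b A)
  have "r ({k \<in> N. k < b} \<union> insert b A) + r ({k \<in> N. k < b} \<inter> insert b A)
      \<le> r {k \<in> N. k < b} + r (insert b A)"
    by (rule submodular_onD[OF sub]) (use insert.prems in auto)
  moreover have "{k \<in> N. k < b} \<union> insert b A = {k \<in> N. k \<le> b}"
    "{k \<in> N. k < b} \<inter> insert b A = A"
    using insert.hyps insert.prems by (auto simp: le_less)
  moreover have "b \<notin> A" using insert.hyps by auto
  moreover have "sum (greedy N r) A \<le> r A" using insert by auto
  ultimately show ?case using insert.hyps(1) by (simp add: greedy_def)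
qed (simp add: r)

lemma sum_greedy_total:
  assumes fin: "finite A" and A: "A \<subseteq> N" "\<And>a k. a \<in> A \<Longrightarrow> k \<in> N \<Longrightarrow> k \<le> a \<Longrightarrow> k \<in> A"
    and r: "r {} = 0"
  shows "sum (greedy N r) A = r A"
  using fin A
proof (induction A rule: finite_linorder_max_induct)
  case (insert b A)
  have "{k \<in> N. k < b} = A"
  proof (intro set_eqI iffI)
    fix k assume k: "k \<in> {k \<in> N. k < b}"
    then have "k \<in> insert b A" using insert.prems(2)[of b k] by auto
    with k show "k \<in> A" by auto
  next
    fix k assume "k \<in> A"
    then show "k \<in> {k \<in> N. k < b}" using insert.hyps insert.prems by auto
  qed
  moreover have "{k \<in> N. k \<le> b} = insert b {k \<in> N. k < b}" using insert.prems by auto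
  moreover have "sum (greedy N r) A = r A"
  proof (rule insert.IH)
    show "k \<in> A" if "a \<in> A" "k \<in> N" "k \<le> a" for a k
      using insert.prems(2)[of a k] that insert.hyps by force
  qed (use insert.prems in auto)
  moreover have "b \<notin> A" using insert.hyps by auto
  ultimately show ?case using insert.hyps(1) by (simp add: greedy_def)
qed (simp add: r)

text \<open>The greedy point satisfies all constraints of the head and has coordinate sum \<open>r N > t\<close>. Shrinking
  it by a factor \<open>1 - e\<close> leaves slack \<open>e * r B\<close> in the constraint of each nonempty \<open>B\<close>, which is at
  least \<open>e\<close> times the smallest price of an item; this makes room for a small box.\<close>

lemma vol_head_bottom_pos:
  assumes fin: "finite N" and ne: "N \<noteq> {}" and sub: "submodular_on N r"
    and r: "r {} = 0" "\<And>i. i \<in> N \<Longrightarrow> r {i} \<le> 1"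
    and mono: "\<And>I J. I \<subseteq> J \<Longrightarrow> J \<subseteq> N \<Longrightarrow> r I \<le> r J"
    and pos: "\<And>i. i \<in> N \<Longrightarrow> 0 < r {i}" and t: "t < r N"
  shows "0 < vol N (head N r t {})"
proof -
  define d where "d = greedy N r"
  define m where "m = Min ((\<lambda>i. r {i}) ` N)"
  have m: "0 < m" "m \<le> 1" "\<And>i. i \<in> N \<Longrightarrow> m \<le> r {i}"
    using fin ne pos r(2) unfolding m_def by (auto simp: Min_le_iff)
  have dB: "sum d B \<le> r B" if "B \<subseteq> N" for B
    unfolding d_def by (rule sum_greedy_le[OF finite_subset[OF that fin] that sub r(1)])
  have dN: "sum d N = r N"
    unfolding d_def by (rule sum_greedy_total[of N N r, OF fin]) (use r in auto)
  have d1: "d j \<le> 1" if "j \<in> N" for j using dB[of "{j}"] r(2)[OF that] that by simp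
  have d0: "0 \<le> d j" for j
  proof -
    have "r {k \<in> N. k < j} \<le> r {k \<in> N. k \<le> j}" by (rule mono) auto
    then show ?thesis by (simp add: d_def greedy_def)
  qed
  obtain i0 where "i0 \<in> N" using ne by blast
  then have rN: "0 < r N" using pos[of i0] mono[of "{i0}" N] by auto
  (* Shrinking by 1 - e lowers the coordinate sum r N to no less than t. *)
  define e where "e = min 1 ((r N - t) / r N)"
  have e: "0 < e" "e \<le> 1" "e * r N \<le> r N - t"
  proof -
    show "0 < e" "e \<le> 1" using t rN by (auto simp: e_def)
    have "e * r N \<le> ((r N - t) / r N) * r N"
      by (rule mult_right_mono) (use rN in \<open>auto simp: e_def\<close>)
    then show "e * r N \<le> r N - t" using rN by simp
  qed
  (* Adding at most h to every coordinate uses up at most e * m of slack. *)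
  define h where "h = e * m / card N"
  have cN: "1 \<le> real (card N)" using fin ne by (simp add: Suc_leI card_gt_0_iff)
  have h: "0 < h" using e m cN by (simp add: h_def)
  have hB: "card B * h \<le> e * m" if "B \<subseteq> N" for B
  proof -
    have "real (card B) * h \<le> card N * h"
      by (rule mult_right_mono) (use that fin h in \<open>auto intro: card_mono\<close>)
    also have "\<dots> = e * m" using cN by (simp add: h_def)
    finally show ?thesis .
  qed
  define a where "a j = (1 - e) * d j" for j
  have "head N r t {} \<in> sets (leb N)" using head_sets[OF fin, of r t "{}"] by simp
  moreover have "head N r t {} \<subseteq> N \<rightarrow>\<^sub>E {0..1}" by (auto simp: head_def)
  ultimately have S: "head N r t {} \<in> fmeasurable (leb N)" by (intro cube_fmeasurable[OF fin])
  have "(\<Pi>\<^sub>E j\<in>N. {a j..a j + h}) \<subseteq> head N r t {}"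
  proof
    fix y assume y: "y \<in> (\<Pi>\<^sub>E j\<in>N. {a j..a j + h})"
    have yj: "a j \<le> y j" "y j \<le> a j + h" if "j \<in> N" for j
      using PiE_mem[OF y that] by auto
    have "y j \<in> {0..1}" if j: "j \<in> N" for j
    proof -
      have "h \<le> e * m" using hB[of "{j}"] j by simp
      also have "\<dots> \<le> e * 1" using e m by (intro mult_left_mono) auto
      finally have "h \<le> e" by simp
      moreover have "(1 - e) * d j \<le> (1 - e) * 1" using e d1[OF j] by (intro mult_left_mono) auto
      moreover have "0 \<le> (1 - e) * d j" using e d0 by simp
      ultimately show ?thesis using yj[OF j] unfolding a_def by simp
    qed
    moreover have "sum y B \<le> r B" if B: "B \<subseteq> N" for B
    proof (cases "B = {}")
      case False
      then obtain i where i: "i \<in> B" by blast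
      have "sum y B \<le> (\<Sum>j\<in>B. a j + h)" by (rule sum_mono) (use yj B in auto)
      also have "\<dots> = (1 - e) * sum d B + card B * h"
        by (simp add: a_def sum.distrib sum_distrib_left)
      also have "\<dots> \<le> (1 - e) * r B + e * m"
        by (intro add_mono mult_left_mono dB hB B) (use e in auto)
      also have "e * m \<le> e * r B"
      proof (rule mult_left_mono)
        have "r {i} \<le> r B" by (rule mono) (use i B in auto)
        with m(3)[of i] i B show "m \<le> r B" by auto
      qed (use e in auto)
      finally show ?thesis by (simp add: algebra_simps)
    qed (simp add: r)
    moreover have "t \<le> sum y N"
    proof -
      have "t \<le> (1 - e) * r N" using e(3) by (simp add: algebra_simps)
      also have "\<dots> = sum a N" by (simp add: a_def sum_distrib_left[symmetric] dN)
      also have "\<dots> \<le> sum y N" by (rule sum_mono) (use yj in auto)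
      finally show ?thesis .
    qed
    moreover have "y \<in> extensional N" using y by (simp add: PiE_iff)
    ultimately show "y \<in> head N r t {}" by (simp add: head_def r PiE_iff)
  qed
  then show ?thesis by (rule vol_pos_if_box[OF fin S]) (use h in auto)
qed

text \<open>In the decomposition of the excess all terms vanish except those of \<open>J = N\<close>, which is the
  old excess, and of \<open>J = {}\<close>, which is a positive volume.\<close>

lemma excess_strictly_decreasing:
  assumes fin: "finite N" and ne: "N \<noteq> {}" and sub: "submodular_on N r"
    and r: "r {} = 0" "\<And>i. i \<in> N \<Longrightarrow> r {i} \<le> 1"
    and mono: "\<And>I J. I \<subseteq> J \<Longrightarrow> J \<subseteq> N \<Longrightarrow> r I \<le> r J"
    and pos: "\<And>i. i \<in> N \<Longrightarrow> 0 < r {i}" and t: "t < r N"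
    and crit: "\<And>J. J \<subset> N \<Longrightarrow> J \<noteq> {} \<Longrightarrow> excess c J r = 0 \<or> r J = r N"
  shows "excess c N r < excess c N (r(N := t))"
proof -
  let ?g = "\<lambda>J. excess c J r * vol (N - J) (head N r t J)"
  have "excess c N (r(N := t)) = sum ?g (Pow N)"
    by (rule excess_decomposition[OF fin sub r]) (use t in auto)
  also have "\<dots> = sum ?g {{}, N}"
  proof (rule sum.mono_neutral_right)
    show "\<forall>J\<in>Pow N - {{}, N}. ?g J = 0"
    proof
      fix J assume "J \<in> Pow N - {{}, N}"
      then have J: "J \<subset> N" "J \<noteq> {}" by auto
      from crit[OF this] show "?g J = 0"
        using vol_head_top_price[where r = r and t = t, OF fin J(1) _ mono] by auto
    qed
  qed (use fin in auto)
  also have "\<dots> = vol N (head N r t {}) + excess c N r"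
    using ne t vol_head_full[of t r N] by (simp add: excess_empty)
  finally show ?thesis
    using vol_head_bottom_pos[where r = r, OF fin ne sub r mono pos t] by simp
qed

section \<open>Regions of a price schedule and their bodies\<close>

text \<open>A bundle that costs at least as much as \<open>N\<close> imposes no constraint on the body of \<open>N\<close>, since
  coordinates are nonnegative. Its price may therefore be changed as long as it does not drop below
  the price of \<open>N\<close>.\<close>

lemma face_slack_cong:
  assumes fin: "finite N" and eq: "p N = p' N"
    and slack: "\<And>J. J \<subset> N \<Longrightarrow> p J = p' J \<or> (p N \<le> p J \<and> p N \<le> p' J)"
  shows "face N p F = face N p' F"
proof -
  have "sum (fill F x) J - p J \<le> sum (fill F x) N - p N \<longleftrightarrow>
      sum (fill F x) J - p' J \<le> sum (fill F x) N - p' N"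
    if x: "x \<in> (N - F) \<rightarrow>\<^sub>E {0..1}" and J: "J \<subseteq> N" for x J
  proof (cases "J = N")
    case False
    have "0 \<le> fill F x i" if "i \<in> N" for i
    proof (cases "i \<in> F")
      case False
      then show ?thesis using PiE_mem[OF x, of i] that by (simp add: fill_def)
    qed (simp add: fill_def)
    then have "sum (fill F x) J \<le> sum (fill F x) N"
      using fin J by (intro sum_mono2) auto
    moreover have "p J = p' J \<or> (p N \<le> p J \<and> p N \<le> p' J)" using slack[of J] J False by blast
    ultimately show ?thesis using eq by auto
  qed simp
  then show ?thesis unfolding face_def by blast
qed

lemma excess_slack_cong:
  assumes "finite N" "p N = p' N"
    and "\<And>J. J \<subset> N \<Longrightarrow> p J = p' J \<or> (p N \<le> p J \<and> p N \<le> p' J)"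
  shows "excess c N p = excess c N p'"
  by (simp add: excess_def face_slack_cong[of N p p', OF assms])

lemma submodular_on_subset: "submodular n p \<Longrightarrow> N \<subseteq> {1..n} \<Longrightarrow> submodular_on N p"
  unfolding submodular_def submodular_on_def by (meson order_trans)

lemma submodularD:
  "submodular n p \<Longrightarrow> I \<subseteq> {1..n} \<Longrightarrow> J \<subseteq> {1..n} \<Longrightarrow> p (I \<union> J) + p (I \<inter> J) \<le> p I + p J"
  by (simp add: submodular_def)

definition monotone_prices :: "nat \<Rightarrow> (nat set \<Rightarrow> real) \<Rightarrow> bool" where
  "monotone_prices n p \<longleftrightarrow> (\<forall>J\<subseteq>{1..n}. \<forall>I\<subseteq>J. p I \<le> p J)"

lemma region_cube: "x \<in> region n p I \<Longrightarrow> i \<in> {1..n} \<Longrightarrow> 0 \<le> x i \<and> x i \<le> 1"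
proof -
  assume "x \<in> region n p I" and i: "i \<in> {1..n}"
  then have "x \<in> {1..n} \<rightarrow>\<^sub>E {0..1}" by (simp add: region_def)
  from PiE_mem[OF this i] show ?thesis by simp
qed

lemma region_le: "x \<in> region n p I \<Longrightarrow> J \<subseteq> {1..n} \<Longrightarrow> sum x J - p J \<le> sum x I - p I"
  by (simp add: region_def)

text \<open>A point of the projection extends to the region by putting \<open>0\<close> outside \<open>I\<close>; and raising the
  coordinates in \<open>F\<close> to \<open>1\<close> never leaves the region, so projecting them away gives the facet.\<close>

lemma proj_region:
  assumes sub: "submodular n p" and mono: "monotone_prices n p" and I: "I \<subseteq> {1..n}" and F: "F \<subseteq> I"
  shows "proj (I - F) (region n p I) = face I p F"
proof (intro set_eqI iffI)
  have finI: "finite I" using I finite_subset by blast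
  fix y assume "y \<in> proj (I - F) (region n p I)"
  then obtain x where x: "x \<in> region n p I" and y: "y = restrict x (I - F)" by (auto simp: proj_def)
  have "y \<in> (I - F) \<rightarrow>\<^sub>E {0..1}"
    unfolding y using region_cube[OF x] I by (auto simp: PiE_iff)
  moreover have "sum (fill F y) J - p J \<le> sum (fill F y) I - p I" if J: "J \<subseteq> I" for J
  proof -
    have "sum x (I - J) \<le> sum (fill F y) (I - J)"
      by (rule sum_mono) (use region_cube[OF x] I in \<open>auto simp: fill_def y\<close>)
    moreover have "sum x J - p J \<le> sum x I - p I" by (rule region_le[OF x]) (use J I in blast)
    moreover have "sum x I = sum x (I - J) + sum x J"
      "sum (fill F y) I = sum (fill F y) (I - J) + sum (fill F y) J"
      using sum.subset_diff[OF J finI] by blast+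
    ultimately show ?thesis by linarith
  qed
  ultimately show "y \<in> face I p F" by (simp add: face_def)
next
  have finI: "finite I" using I finite_subset by blast
  fix y assume y: "y \<in> face I p F"
  then have yc: "y \<in> (I - F) \<rightarrow>\<^sub>E {0..1}" by (simp add: face_def)
  define x where "x = (\<lambda>i\<in>{1..n}. if i \<in> I then fill F y i else 0)"
  have "restrict x (I - F) i = y i" for i
    using yc I by (cases "i \<in> I - F") (auto simp: x_def fill_def PiE_iff extensional_def)
  then have "restrict x (I - F) = y" by blast
  moreover have "x \<in> region n p I"
  proof -
    have "x i \<in> {0..1}" if "i \<in> {1..n}" for i
      using PiE_mem[OF yc, of i] that by (auto simp: x_def fill_def)
    then have "x \<in> {1..n} \<rightarrow>\<^sub>E {0..1}" by (intro PiE_I) (auto simp: x_def)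
    moreover have "sum x J - p J \<le> sum x I - p I" if J: "J \<subseteq> {1..n}" for J
    proof -
      have "sum x J = sum x (J \<inter> I)"
        by (rule sum.mono_neutral_right) (use J finite_subset[OF J] in \<open>auto simp: x_def\<close>)
      moreover have "sum x (J \<inter> I) = sum (fill F y) (J \<inter> I)" "sum x I = sum (fill F y) I"
        using J I by (auto intro!: sum.cong simp: x_def)
      moreover have "sum (fill F y) (J \<inter> I) - p (J \<inter> I) \<le> sum (fill F y) I - p I"
        using y unfolding face_def by blast
      (* Items outside I have value 0, and J \<inter> I costs no more than J. *)
      moreover have "p (J \<inter> I) \<le> p J" using mono J unfolding monotone_prices_def by blast
      ultimately show ?thesis by linarith
    qed
    ultimately show ?thesis by (simp add: region_def)
  qed
  ultimately show "y \<in> proj (I - F) (region n p I)" unfolding proj_def by force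
qed

lemma delta_eq_excess:
  assumes sub: "submodular n p" and mono: "monotone_prices n p" and I: "I \<subseteq> {1..n}"
  shows "delta n p I = excess (1 / (real n + 1)) I p"
proof -
  have "proj I (region n p I) = face I p {}"
    using proj_region[OF assms, of "{}"] by simp
  moreover have "proj (I - {i}) (region n p I) = face I p {i}" if "i \<in> I" for i
    using proj_region[OF assms, of "{i}"] that by simp
  ultimately show ?thesis by (simp add: delta_def excess_def)
qed

lemma vol_region_zero_if_price_not_greater:
  assumes I: "I \<subset> J" "J \<subseteq> {1..n}" and p: "p J \<le> p I"
  shows "vol {1..n} (region n p I) = 0"
proof -
  obtain j where j: "j \<in> J" "j \<notin> I" using I by blast
  have finJ: "finite J" using I finite_subset by blast
  have "x j = 0" if x: "x \<in> region n p I" for x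
  proof -
    have "sum x J - p J \<le> sum x I - p I" by (rule region_le[OF x I(2)])
    moreover have "sum x J = sum x (J - I) + sum x I"
      by (rule sum.subset_diff) (use I finJ in auto)
    moreover have "x j \<le> sum x (J - I)"
      by (rule member_le_sum) (use j I finJ region_cube[OF x] in auto)
    moreover have "0 \<le> x j" using region_cube[OF x, of j] j I by auto
    ultimately show ?thesis using p by simp
  qed
  then have "region n p I \<subseteq> {x \<in> {1..n} \<rightarrow>\<^sub>E UNIV. x j = 0}"
    by (auto simp: region_def PiE_iff)
  then show ?thesis
    by (rule vol_subset_coordinate_hyperplane[rotated 2]) (use j I in auto)
qed

lemma single_price_less_1:
  assumes i: "i \<in> {1..n}" and p: "p {} = 0" and pos: "0 < vol {1..n} (region n p {i})"
  shows "p {i} < 1"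
proof (rule ccontr)
  assume "\<not> p {i} < 1"
  then have "x i = 1" if x: "x \<in> region n p {i}" for x
    using region_le[OF x, of "{}"] region_cube[OF x i] p by auto
  then have "region n p {i} \<subseteq> {x \<in> {1..n} \<rightarrow>\<^sub>E UNIV. x i = 1}"
    by (auto simp: region_def PiE_iff)
  then have "vol {1..n} (region n p {i}) = 0"
    by (rule vol_subset_coordinate_hyperplane[rotated 2]) (use i in auto)
  with pos show False by simp
qed

lemma normalized_price_attained:
  assumes norm: "normalized n p" and I: "I \<subset> {1..n}" and v: "vol {1..n} (region n p I) = 0"
  shows "\<exists>J. I \<subset> J \<and> J \<subseteq> {1..n} \<and> p I = p J" and "\<And>J. I \<subset> J \<Longrightarrow> J \<subseteq> {1..n} \<Longrightarrow> p I \<le> p J"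
proof -
  let ?U = "{J. J \<subseteq> {1..n} \<and> I \<subset> J}"
  have eq: "p I = Min (p ` ?U)" using norm I v unfolding normalized_def by blast
  have fin: "finite (p ` ?U)" by simp
  have "p ` ?U \<noteq> {}" using I by blast
  from Min_in[OF fin this] obtain J where "J \<in> ?U" "p I = p J" unfolding eq by (rule imageE) auto
  then show "\<exists>J. I \<subset> J \<and> J \<subseteq> {1..n} \<and> p I = p J" by blast
  show "p I \<le> p J" if "I \<subset> J" "J \<subseteq> {1..n}" for J
    unfolding eq by (rule Min_le[OF fin]) (use that in blast)
qed

text \<open>A bundle that is not cheaper than a larger one has a null region, and normalization sets its
  price to the least price of a larger bundle.\<close>

lemma normalized_monotone:
  assumes norm: "normalized n p"
  shows "monotone_prices n p"
  unfolding monotone_prices_def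
proof (intro allI impI)
  fix J I :: "nat set" assume J: "J \<subseteq> {1..n}" and I: "I \<subseteq> J"
  show "p I \<le> p J"
  proof (cases "I = J \<or> vol {1..n} (region n p I) \<noteq> 0")
    case True
    then show ?thesis
      using vol_region_zero_if_price_not_greater[of I J n p] I J by fastforce
  next
    case False
    then show ?thesis by (intro normalized_price_attained(2)[OF norm]) (use I J in auto)
  qed
qed

text \<open>The properties of a price schedule under which \<open>\<delta>\<close> is strictly decreasing in the price. By
  submodularity the bound on single items bounds all marginal prices.\<close>

definition sound_prices :: "nat \<Rightarrow> (nat set \<Rightarrow> real) \<Rightarrow> bool" where
  "sound_prices n p \<longleftrightarrow> p {} = 0 \<and> submodular n p \<and> monotone_prices n p \<and>
     (\<forall>i\<in>{1..n}. 0 < p {i} \<and> p {i} \<le> 1)"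

text \<open>Two price schedules need not agree below \<open>N\<close> for the comparison: bundles that impose no
  constraint at the lower price of \<open>N\<close> are allowed to differ.\<close>

lemma delta_less_if_price_greater:
  assumes r: "sound_prices n r" and p: "sound_prices n p" and N: "N \<subseteq> {1..n}" "N \<noteq> {}"
    and less: "p N < r N"
    and slack: "\<And>J. J \<subset> N \<Longrightarrow> p J = r J \<or> (p N \<le> p J \<and> p N \<le> r J)"
    and crit: "\<And>J. J \<subset> N \<Longrightarrow> J \<noteq> {} \<Longrightarrow> delta n r J = 0 \<or> r J = r N"
  shows "delta n r N < delta n p N"
proof -
  let ?c = "1 / (real n + 1)"
  have fin: "finite N" using N finite_subset by blast
  have de: "delta n r J = excess ?c J r" if "J \<subseteq> {1..n}" for J
    using r that by (intro delta_eq_excess) (auto simp: sound_prices_def)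
  have "excess ?c N r < excess ?c N (r(N := p N))"
  proof (rule excess_strictly_decreasing[OF fin N(2)])
    show "submodular_on N r" by (rule submodular_on_subset[OF _ N(1)]) (use r in \<open>simp add: sound_prices_def\<close>)
    show "r I \<le> r J" if "I \<subseteq> J" "J \<subseteq> N" for I J
      using r that N unfolding sound_prices_def monotone_prices_def by (meson order_trans)
    show "excess ?c J r = 0 \<or> r J = r N" if "J \<subset> N" "J \<noteq> {}" for J
      using crit[OF that] de[of J] that N by auto
  qed (use r N less in \<open>auto simp: sound_prices_def\<close>)
  also have "excess ?c N (r(N := p N)) = excess ?c N p"
  proof (rule excess_slack_cong[OF fin])
    fix J assume "J \<subset> N"
    with slack[OF this] show "(r(N := p N)) J = p J \<or>
        ((r(N := p N)) N \<le> (r(N := p N)) J \<and> (r(N := p N)) N \<le> p J)" by auto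
  qed simp
  also have "\<dots> = delta n p N"
    using p N by (intro delta_eq_excess[symmetric]) (auto simp: sound_prices_def)
  finally show ?thesis using de[OF N(1)] by simp
qed

lemma prices_determined_by_delta:
  assumes p: "sound_prices n p" and r: "sound_prices n r"
    and crit: "\<And>J. J \<subseteq> {1..n} \<Longrightarrow> J \<noteq> {} \<Longrightarrow> card J \<le> k \<Longrightarrow> delta n p J = 0 \<and> delta n r J = 0"
  shows "J \<subseteq> {1..n} \<Longrightarrow> card J \<le> k \<Longrightarrow> p J = r J"
proof (induction "card J" arbitrary: J rule: less_induct)
  case less
  have finJ: "finite J" using less.prems finite_subset by blast
  have below: "K \<subseteq> {1..n}" "card K \<le> k" "p K = r K" if "K \<subset> J" for K
  proof -
    have c: "card K < card J" by (rule psubset_card_mono[OF finJ that])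
    show "K \<subseteq> {1..n}" "card K \<le> k" using c that less.prems by auto
    then show "p K = r K" using less.hyps[OF c] by blast
  qed
  show ?case
  proof (cases "J = {}")
    case True
    then show ?thesis using p r by (simp add: sound_prices_def)
  next
    case False
    have eq: "delta n p J = 0" "delta n r J = 0" using crit[OF less.prems(1) False less.prems(2)] by auto
    have "\<not> p J < r J"
    proof
      assume "p J < r J"
      then have "delta n r J < delta n p J"
        by (rule delta_less_if_price_greater[OF r p less.prems(1) False]) (use below crit in auto)
      with eq show False by simp
    qed
    moreover have "\<not> r J < p J"
    proof
      assume "r J < p J"
      then have "delta n p J < delta n r J"
        by (rule delta_less_if_price_greater[OF p r less.prems(1) False]) (use below crit in auto)
      with eq show False by simp
    qed
    ultimately show ?thesis by simp
  qed
qed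

section \<open>Uniqueness of critical price schedules\<close>

lemma bundlesI: "J \<subseteq> {1..n} \<Longrightarrow> J \<noteq> {} \<Longrightarrow> card J \<le> k \<Longrightarrow> J \<in> bundles k n"
  using finite_subset[of J "{1..n}"] by (simp add: bundles_def Suc_le_eq card_gt_0_iff)

lemma candidateD:
  assumes "p \<in> sja_candidates n k"
  shows "price_schedule n p" "normalized n p" "submodular n p" "monotone_prices n p"
    and "\<And>I. I \<subseteq> {1..n} \<Longrightarrow> vol {1..n} (region n p I) > 0 \<longleftrightarrow> I \<in> bundles k n"
    and "\<And>I. I \<in> bundles k n \<Longrightarrow> I \<noteq> {} \<Longrightarrow> delta n p I = 0"
  using assms normalized_monotone by (auto simp: sja_candidates_def critical_def)

lemma price_empty: "price_schedule n p \<Longrightarrow> p {} = 0"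
  by (simp add: price_schedule_def)

lemma sound_pricesI:
  assumes p: "price_schedule n p" "normalized n p" "submodular n p"
    and e: "0 < vol {1..n} (region n p {})"
    and s: "\<And>i. i \<in> {1..n} \<Longrightarrow> 0 < vol {1..n} (region n p {i})"
  shows "sound_prices n p"
proof -
  have "0 < p {i} \<and> p {i} \<le> 1" if i: "i \<in> {1..n}" for i
  proof
    show "0 < p {i}"
    proof (rule ccontr)
      assume "\<not> 0 < p {i}"
      then have "vol {1..n} (region n p {}) = 0"
        by (intro vol_region_zero_if_price_not_greater[of "{}" "{i}"])
           (use i price_empty[OF p(1)] in auto)
      with e show False by simp
    qed
    show "p {i} \<le> 1" using single_price_less_1[of i n p] i price_empty[OF p(1)] s[OF i] by simp
  qed
  then show ?thesis
    using p normalized_monotone[OF p(2)] price_empty[OF p(1)] by (simp add: sound_prices_def)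
qed

lemma candidate_sound:
  assumes p: "p \<in> sja_candidates n k" and k: "1 \<le> k"
  shows "sound_prices n p"
proof (rule sound_pricesI[OF candidateD(1-3)[OF p]])
  show "0 < vol {1..n} (region n p {})"
    using candidateD(5)[OF p, of "{}"] by (simp add: bundles_def)
  show "0 < vol {1..n} (region n p {i})" if "i \<in> {1..n}" for i
    using candidateD(5)[OF p, of "{i}"] that k by (simp add: bundles_def)
qed

text \<open>Normalization passes the price of the full bundle down through all bundles with null regions.\<close>

lemma price_outside_bundles:
  assumes p: "p \<in> sja_candidates n k"
  shows "J \<subseteq> {1..n} \<Longrightarrow> k < card J \<Longrightarrow> p J = p {1..n}"
proof (induction "n - card J" arbitrary: J rule: less_induct)
  case less
  show ?case
  proof (cases "J = {1..n}")
    case False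
    then have "J \<notin> bundles k n" using less.prems by (auto simp: bundles_def)
    then have "vol {1..n} (region n p J) = 0"
      using candidateD(5)[OF p less.prems(1)] vol_nonneg[of "{1..n}" "region n p J"] by linarith
    then obtain K where K: "J \<subset> K" "K \<subseteq> {1..n}" "p J = p K"
      using normalized_price_attained(1)[OF candidateD(2)[OF p], of J] False less.prems(1) by blast
    have "finite K" using K finite_subset by blast
    then have "card J < card K" using K(1) by (rule psubset_card_mono)
    moreover have "card K \<le> n" using card_mono[OF _ K(2)] by simp
    ultimately have "p K = p {1..n}" using less.prems(2) by (intro less.hyps K(2)) auto
    with K(3) show ?thesis by simp
  qed simp
qed

text \<open>Above size \<open>k\<close> the two candidates may differ, but there each bundle costs as much as the full one,
  so it is slack in the body of \<open>{1..n}\<close>, and its head is a null set.\<close>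

lemma candidate_top_not_less:
  assumes p: "p \<in> sja_candidates n k" and r: "r \<in> sja_candidates n k" and k: "1 \<le> k" and n: "1 \<le> n"
    and below: "\<And>J. J \<subseteq> {1..n} \<Longrightarrow> card J \<le> k \<Longrightarrow> p J = r J"
  shows "\<not> p {1..n} < r {1..n}"
proof
  assume less: "p {1..n} < r {1..n}"
  have "delta n r {1..n} < delta n p {1..n}"
  proof (rule delta_less_if_price_greater[OF candidate_sound[OF r k] candidate_sound[OF p k] _ _ less])
    show "{1..n} \<noteq> {}" using n by simp
    fix J assume J: "J \<subset> {1..n}"
    show "p J = r J \<or> (p {1..n} \<le> p J \<and> p {1..n} \<le> r J)"
      using below[of J] price_outside_bundles[OF p, of J] price_outside_bundles[OF r, of J] J less
      by (cases "card J \<le> k") auto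
    assume ne: "J \<noteq> {}"
    have finJ: "finite J" using J finite_subset by blast
    show "delta n r J = 0 \<or> r J = r {1..n}"
    proof (cases "card J \<le> k")
      case True
      then have "J \<in> bundles k n"
        using J ne finJ by (auto simp: bundles_def Suc_le_eq card_gt_0_iff)
      then show ?thesis using candidateD(6)[OF r _ ne] by blast
    next
      case False
      then show ?thesis using price_outside_bundles[OF r, of J] J by auto
    qed
  qed simp
  moreover have "{1..n} \<in> bundles k n" by (simp add: bundles_def)
  ultimately show False using candidateD(6)[OF r, of "{1..n}"] candidateD(6)[OF p, of "{1..n}"] n by simp
qed

lemma sja_candidate_unique:
  assumes p: "p \<in> sja_candidates n k" and r: "r \<in> sja_candidates n k" and k: "1 \<le> k" and n: "1 \<le> n"
  shows "p = r"
proof -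
  have below: "p J = r J" if "J \<subseteq> {1..n}" "card J \<le> k" for J
  proof (rule prices_determined_by_delta[OF candidate_sound[OF p k] candidate_sound[OF r k] _ that])
    fix K assume "K \<subseteq> {1..n}" "K \<noteq> {}" "card K \<le> k"
    then show "delta n p K = 0 \<and> delta n r K = 0"
      using candidateD(6)[OF p] candidateD(6)[OF r] bundlesI by blast
  qed
  then have top: "p {1..n} = r {1..n}"
    using candidate_top_not_less[OF p r k n] candidate_top_not_less[OF r p k n] by force
  have "p J = r J" if "J \<in> Pow {1..n}" for J
    using below[of J] price_outside_bundles[OF p, of J] price_outside_bundles[OF r, of J] top that
    by (cases "card J \<le> k") auto
  then show ?thesis
    using candidateD(1)[OF p] candidateD(1)[OF r]
    by (intro extensionalityI[of _ "Pow {1..n}"]) (auto simp: price_schedule_def)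
qed

lemma SJA_eqI:
  assumes q: "q \<in> sja_candidates n k" and k: "1 \<le> k" "k \<le> n"
    and max: "\<And>j. k < j \<Longrightarrow> j \<le> n \<Longrightarrow> sja_candidates n j = {}"
  shows "q = SJA n"
proof -
  have "Max {k \<in> {1..n}. sja_candidates n k \<noteq> {}} = k"
  proof (rule Max_eqI)
    show "j \<le> k" if "j \<in> {k \<in> {1..n}. sja_candidates n k \<noteq> {}}" for j
      using max[of j] that by (cases "k < j") auto
  qed (use q k in auto)
  moreover have "(THE p. p \<in> sja_candidates n k) = q"
  proof (rule the_equality)
    show "p = q" if "p \<in> sja_candidates n k" for p
      by (rule sja_candidate_unique[OF that q k(1)]) (use k in simp)
  qed (rule q)
  ultimately show ?thesis by (simp add: SJA_def)
qed

lemma card_subset_cases: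
  assumes J: "J \<subseteq> {1..n::nat}" and c: "\<not> card J \<le> n - 2"
  shows "J = {1..n} \<or> card J = n - 1"
proof -
  have "card J \<le> n" using card_mono[OF _ J] by simp
  then consider "card J = n" | "card J = n - 1" using c by linarith
  then show ?thesis using card_subset_eq[OF _ J] by cases auto
qed

text \<open>The shape of \<open>q\<close> when bundles of size \<open>n - 1\<close> have null regions is incompatible with a candidate
  \<open>r\<close> whose regions all have positive volume: as \<open>\<delta>\<close> decreases in the price, \<open>q \<le> r\<close> holds at
  size \<open>n - 1\<close>, so \<open>q\<close> charges strictly less than \<open>r\<close> for the full bundle, and its \<open>\<delta>\<close> there is
  positive.\<close>

lemma no_full_candidate:
  assumes q: "sound_prices n q" and n: "2 \<le> n"
    and small: "\<And>J. J \<subseteq> {1..n} \<Longrightarrow> J \<noteq> {} \<Longrightarrow> card J \<le> n - 2 \<Longrightarrow> delta n q J = 0"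
    and top: "delta n q {1..n} = 0"
    and big: "\<And>J. J \<subseteq> {1..n} \<Longrightarrow> card J = n - 1 \<Longrightarrow> 0 \<le> delta n q J \<and> q J = q {1..n}"
  shows "sja_candidates n n = {}"
proof (rule ccontr)
  assume "sja_candidates n n \<noteq> {}"
  then obtain r where r: "r \<in> sja_candidates n n" by blast
  have sr: "sound_prices n r" by (rule candidate_sound[OF r]) (use n in simp)
  have all: "J \<in> bundles n n" if "J \<subseteq> {1..n}" "J \<noteq> {}" for J
    using that card_mono[of "{1..n}" J] by (intro bundlesI) auto
  have dr: "delta n r J = 0" if "J \<subseteq> {1..n}" "J \<noteq> {}" for J
    using candidateD(6)[OF r all[OF that] that(2)] .
  have below: "q J = r J" if "J \<subseteq> {1..n}" "card J \<le> n - 2" for J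
    by (rule prices_determined_by_delta[OF q sr _ that]) (use small dr in auto)
  have le: "q J \<le> r J" if J: "J \<subseteq> {1..n}" "card J = n - 1" for J
  proof (rule ccontr)
    assume "\<not> q J \<le> r J"
    then have less: "r J < q J" by simp
    have ne: "J \<noteq> {}" using J n by auto
    have finJ: "finite J" using J finite_subset by blast
    have K: "K \<subseteq> {1..n}" "card K \<le> n - 2" if "K \<subset> J" for K
      using psubset_card_mono[OF finJ that] that J by auto
    have "delta n q J < delta n r J"
      by (rule delta_less_if_price_greater[OF q sr J(1) ne less]) (use below small K in auto)
    then show False using big[OF J] dr[OF J(1) ne] by simp
  qed
  have Nne: "{1..n} \<noteq> {}" using n by simp
  (* Any bundle of size n - 1 serves to compare the prices of the full bundle. *)
  define I where "I = {1..n-1}"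
  have I: "I \<subset> {1..n}" "card I = n - 1" using n by (auto simp: I_def)
  have "0 < vol {1..n} (region n r I)"
    using candidateD(5)[OF r, of I] all[of I] I n by (auto simp: I_def)
  then have "r I < r {1..n}"
    using vol_region_zero_if_price_not_greater[OF I(1) order_refl, of r] by force
  then have less: "q {1..n} < r {1..n}" using le[of I] big[of I] I by (auto simp: psubset_imp_subset)
  have "delta n r {1..n} < delta n q {1..n}"
  proof (rule delta_less_if_price_greater[OF sr q order_refl Nne less])
    fix J assume J: "J \<subset> {1..n}"
    show "q J = r J \<or> (q {1..n} \<le> q J \<and> q {1..n} \<le> r J)"
    proof (cases "card J \<le> n - 2")
      case False
      then have "card J = n - 1" using card_subset_cases[of J n] J by blast
      then show ?thesis using le[of J] big[of J] J by auto
    qed (use below J in auto)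
    show "delta n r J = 0 \<or> r J = r {1..n}" if "J \<noteq> {}" using dr J that by auto
  qed
  then show False using dr[OF order_refl Nne] top by simp
qed

section \<open>Regions of nondegenerate symmetric price schedules\<close>

lemma submodular_strict:
  assumes sub: "submodular n q" and nd: "\<not> degenerate n q"
    and IJ: "I \<subseteq> {1..n}" "J \<subseteq> {1..n}" "\<not> I \<subseteq> J" "\<not> J \<subseteq> I"
  shows "q (I \<union> J) + q (I \<inter> J) < q I + q J"
proof -
  have "\<not> tight_pair n q I J"
    using nd IJ(1) unfolding degenerate_def tight_def right_tight_def by blast
  then show ?thesis using submodularD[OF sub IJ(1,2)] IJ by (simp add: tight_pair_def)
qed

text \<open>A null region forces \<open>q I = q (insert i I)\<close> for some \<open>i\<close>, hence for all \<open>i\<close> outside \<open>I\<close> by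
  symmetry. With two such items \<open>i\<close> and \<open>j\<close>, strict submodularity makes the bundle with both
  cheaper than \<open>I\<close>, against monotonicity.\<close>

lemma null_region_bundle:
  assumes norm: "normalized n q" and sub: "submodular n q" and sym: "symmetric n q"
    and nd: "\<not> degenerate n q" and I: "I \<subset> {1..n}" and v: "vol {1..n} (region n q I) = 0"
  shows "card I = n - 1" "q I = q {1..n}"
proof -
  note mono = normalized_monotone[OF norm, unfolded monotone_prices_def, rule_format]
  obtain J where J: "I \<subset> J" "J \<subseteq> {1..n}" "q I = q J"
    using normalized_price_attained(1)[OF norm I v] by blast
  obtain i where i: "i \<in> J" "i \<notin> I" using J(1) by blast
  have iN: "i \<in> {1..n}" using i J by blast
  have finI: "finite I" using I finite_subset by blast
  have "q I \<le> q (insert i I)" by (rule mono) (use I iN in auto)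
  moreover have "q (insert i I) \<le> q J" by (rule mono) (use J i in auto)
  ultimately have qi: "q (insert i I) = q I" using J(3) by simp
  have full: "insert i I = {1..n}"
  proof (rule ccontr)
    assume "insert i I \<noteq> {1..n}"
    then obtain j where j: "j \<in> {1..n}" "j \<notin> I" "j \<noteq> i" using I iN by blast
    have "q (insert j I) = q (insert i I)"
      using sym I iN j i finI unfolding symmetric_def by (auto simp: psubset_imp_subset)
    moreover have "q (insert i I \<union> insert j I) + q (insert i I \<inter> insert j I) < q (insert i I) + q (insert j I)"
      by (rule submodular_strict[OF sub nd]) (use I iN j i in auto)
    moreover have "insert i I \<inter> insert j I = I" using j i by auto
    moreover have "q I \<le> q (insert i I \<union> insert j I)" by (rule mono) (use I iN j in auto)
    ultimately show False using qi by simp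
  qed
  have "card (insert i I) = n" unfolding full by simp
  then show "card I = n - 1" using finI i by simp
  show "q I = q {1..n}" using qi full by simp
qed

text \<open>All marginal prices are at most \<open>1 - e\<close> for some \<open>e > 0\<close>, so whoever values each item at \<open>1 - e\<close>
  or more takes everything.\<close>

lemma vol_region_full_pos:
  assumes sub: "submodular n q" and q: "q {} = 0" and mono: "monotone_prices n q"
    and s: "\<And>i. i \<in> {1..n} \<Longrightarrow> q {i} < 1"
  shows "0 < vol {1..n} (region n q {1..n})"
proof -
  define e where "e = Min (insert 1 ((\<lambda>i. 1 - q {i}) ` {1..n}))"
  have e: "0 < e" "e \<le> 1" unfolding e_def using s by auto
  have e_le: "q {i} \<le> 1 - e" if "i \<in> {1..n}" for i
  proof -
    have "e \<le> 1 - q {i}" unfolding e_def using that by (intro Min_le) auto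
    then show ?thesis by simp
  qed
  have marg: "q (J \<union> B) \<le> q J + card B * (1 - e)"
    if "finite B" "B \<subseteq> {1..n}" "J \<subseteq> {1..n}" "B \<inter> J = {}" for B J
    by (rule marginal_price_le[OF submodular_on_subset[OF sub order_refl] q e_le that])
  have "region n q {1..n} = face {1..n} q {}"
    by (auto simp: region_def face_def)
  then have "region n q {1..n} \<in> sets (leb {1..n})" using face_sets[of "{1..n}" q "{}"] by simp
  then have S: "region n q {1..n} \<in> fmeasurable (leb {1..n})"
    by (intro cube_fmeasurable) (auto simp: region_def)
  have "(\<Pi>\<^sub>E i\<in>{1..n}. {1 - e..1}) \<subseteq> region n q {1..n}"
  proof
    fix x assume x: "x \<in> (\<Pi>\<^sub>E i\<in>{1..n}. {1 - e..1})"
    have xi: "1 - e \<le> x i" "x i \<le> 1" if "i \<in> {1..n}" for i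
      using PiE_mem[OF x that] by auto
    have "x \<in> {1..n} \<rightarrow>\<^sub>E {0..1}" 
    proof (rule PiE_I)
      show "x i \<in> {0..1}" if "i \<in> {1..n}" for i using xi[OF that] e by simp
      show "x i = undefined" if "i \<notin> {1..n}" for i by (rule PiE_arb[OF x that])
    qed
    moreover have "sum x J - q J \<le> sum x {1..n} - q {1..n}" if J: "J \<subseteq> {1..n}" for J
    proof -
      have "card ({1..n} - J) * (1 - e) = (\<Sum>i\<in>{1..n} - J. 1 - e)" by simp
      also have "\<dots> \<le> sum x ({1..n} - J)" by (rule sum_mono) (use xi in auto)
      finally have "card ({1..n} - J) * (1 - e) \<le> sum x ({1..n} - J)" .
      moreover have "q (J \<union> ({1..n} - J)) \<le> q J + card ({1..n} - J) * (1 - e)"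
        by (rule marg) (use J in auto)
      moreover have "J \<union> ({1..n} - J) = {1..n}" using J by auto
      moreover have "sum x {1..n} = sum x ({1..n} - J) + sum x J"
        by (rule sum.subset_diff) (use J in auto)
      ultimately show ?thesis by simp
    qed
    ultimately show "x \<in> region n q {1..n}" by (simp add: region_def)
  qed
  from vol_pos_if_box[where a = "\<lambda>_. 1 - e" and b = "\<lambda>_. 1", OF _ S this]
  show ?thesis using e by simp
qed

section \<open>One and two items\<close>

lemma unit_interval_above:
  assumes "0 \<le> P"
  shows "{x \<in> {i} \<rightarrow>\<^sub>E {0..1::real}. P \<le> x i} = {i} \<rightarrow>\<^sub>E {P..1}"
  by (rule set_eqI) (use assms in \<open>simp add: PiE_iff, linarith\<close>)

lemma unit_square_iff:
  "x \<in> {1, 2} \<rightarrow>\<^sub>E {0..1::real} \<longleftrightarrow>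
     x \<in> space (leb {1, 2}) \<and> 0 \<le> x 1 \<and> x 1 \<le> 1 \<and> 0 \<le> x 2 \<and> x 2 \<le> 1"
  by (simp add: space_leb PiE_iff conj_ac)

text \<open>When two items cost as much together as each of them alone, the constraints from the single items
  are void.\<close>

lemma uniform_pair_face:
  assumes q: "q {} = 0" "q {1} = P" "q {2} = P" "q {1, 2} = P"
  shows "face {1, 2} q F = {x \<in> ({1, 2} - F) \<rightarrow>\<^sub>E {0..1}. P \<le> fill F x 1 + fill F x 2}"
proof -
  have "(\<forall>J\<subseteq>{1, 2}. sum (fill F x) J - q J \<le> sum (fill F x) {1, 2} - q {1, 2}) \<longleftrightarrow>
      P \<le> fill F x 1 + fill F x 2" if x: "x \<in> ({1, 2} - F) \<rightarrow>\<^sub>E {0..1}" for x :: "nat \<Rightarrow> real"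
  proof -
    have "0 \<le> fill F x i" if "i \<in> {1, 2}" for i
    proof (cases "i \<in> F")
      case False
      then show ?thesis using PiE_mem[OF x, of i] that by (simp add: fill_def)
    qed (simp add: fill_def)
    then have nn: "0 \<le> fill F x 1" "0 \<le> fill F x 2" by auto
    have "(\<forall>J\<subseteq>{1, 2}. R J) \<longleftrightarrow> R {} \<and> R {1} \<and> R {2} \<and> R {1, 2}" for R :: "nat set \<Rightarrow> bool"
      unfolding Pow_iff[symmetric] Ball_def[symmetric] by (auto simp: Pow_insert)
    then show ?thesis using nn q by simp
  qed
  then show ?thesis unfolding face_def by blast
qed

lemma uniform_single_delta:
  assumes q: "q {} = 0" "q {1} = P" and P: "0 \<le> P" "P \<le> 1"
    and n: "1 \<le> n" and sub: "submodular n q" and mono: "monotone_prices n q"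
  shows "delta n q {1} = 1 - P - 1 / (real n + 1)"
proof -
  have all: "(\<forall>J\<subseteq>{1}. R J) \<longleftrightarrow> R {} \<and> R {1}" for R :: "nat set \<Rightarrow> bool"
    by (auto simp: subset_singleton_iff)
  have "face {1} q {} = {x \<in> {1} \<rightarrow>\<^sub>E {0..1}. P \<le> x 1}"
    unfolding face_def all using q by simp
  also have "\<dots> = {1} \<rightarrow>\<^sub>E {P..1}" by (rule unit_interval_above[OF P(1)])
  finally have "vol {1} (face {1} q {}) = 1 - P"
    using vol_box[of "{1}" "\<lambda>_. P" "\<lambda>_. 1"] P by simp
  moreover have "face {1} q {1} = {\<lambda>_. undefined}"
    unfolding face_def all using q P by (simp add: fill_def)
  ultimately show ?thesis
    using delta_eq_excess[OF sub mono, of "{1}"] n by (simp add: excess_def vol_point)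
qed

text \<open>Here the body is the unit square cut by the line \<open>x_1 + x_2 = P\<close>. For \<open>P \<le> 1\<close>, the
  condition on a single item gives \<open>P \<le> 2/3\<close>; then the area is at least \<open>1 - P\<^sup>2 / 2\<close>, too large for
  the facets. For \<open>P > 1\<close> the body is a triangle with legs \<open>s = 2 - P < 1\<close>, and its area \<open>s\<^sup>2 / 2\<close>
  is less than a third of its facets \<open>2 * s\<close>. The value \<open>delta 2 q {1} \<ge> 0\<close> does not rule out
  \<open>P > 1\<close>, since the region of a single item is then empty.\<close>

lemma no_uniform_pair_prices:
  assumes q: "q {} = 0" "q {1} = P" "q {2} = P" "q {1, 2} = P"
    and sub: "submodular 2 q" and mono: "monotone_prices 2 q"
    and vol: "0 < vol {1, 2} (face {1, 2} q {})"
    and d1: "0 \<le> delta 2 q {1}"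
  shows "delta 2 q {1, 2} \<noteq> 0"
proof -
  let ?D = "face {1, 2} q {}"
  have D: "?D = {x \<in> {1, 2} \<rightarrow>\<^sub>E {0..1}. P \<le> x 1 + x 2}"
    using uniform_pair_face[OF q, of "{}"] by simp
  have D_iff: "x \<in> ?D \<longleftrightarrow> x \<in> space (leb {1, 2}) \<and> 0 \<le> x 1 \<and> x 1 \<le> 1 \<and> 0 \<le> x 2 \<and> x 2 \<le> 1
      \<and> P \<le> x 1 + x 2" for x
    unfolding D mem_Collect_eq unit_square_iff by blast
  have Dsets: "?D \<in> sets (leb {1, 2})" using face_sets[of "{1, 2}" q "{}"] by simp
  have D_fm: "?D \<in> fmeasurable (leb {1, 2})"
    by (rule cube_fmeasurable[OF _ _ Dsets]) (simp_all add: face_def)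
  have P0: "0 \<le> P"
    using mono q unfolding monotone_prices_def
    by (metis bot.extremum empty_subsetI insert_subset atLeastAtMost_iff one_le_numeral order_refl)
  have minus: "{1::nat, 2} - {1} = {2}" "{1::nat, 2} - {2} = {1}" by auto
  then have dN: "delta 2 q {1, 2} = vol {1, 2} ?D
      - 1 / 3 * (vol {2} (face {1, 2} q {1}) + vol {1} (face {1, 2} q {2}))"
    using delta_eq_excess[OF sub mono, of "{1, 2}"] by (simp add: excess_def)
  have P2: "P < 2"
  proof (rule ccontr)
    assume "\<not> P < 2"
    then have "?D \<subseteq> {x \<in> {1, 2} \<rightarrow>\<^sub>E UNIV. x 1 = 1}"
      unfolding subset_iff D_iff space_leb by simp
    then have "vol {1, 2} ?D = 0" by (rule vol_subset_coordinate_hyperplane[rotated 2]) auto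
    with vol show False by simp
  qed
  show ?thesis
  proof (cases "P \<le> 1")
    case True
    have P23: "P \<le> 2/3" using uniform_single_delta[OF q(1,2) P0 True _ sub mono] d1 by simp
    (* T is the closed triangle that the line cuts off at the origin. *)
    define T where "T = {x \<in> space (leb {1, 2}). 0 \<le> x 2 \<and> x 2 \<le> P \<and> 0 \<le> x 1 \<and> x 1 \<le> P - x 2}"
    note area = vol_between_graphs[where l = "\<lambda>_. 0" and u = "\<lambda>x. P - x" and U = "\<lambda>x. P * x - x\<^sup>2 / 2"]
    have T_fm: "T \<in> fmeasurable (leb {1, 2})"
      unfolding T_def by (rule area(1)) (use P0 in \<open>auto intro!: derivative_eq_intros\<close>)
    have T_vol: "vol {1, 2} T = (P * P - P\<^sup>2 / 2) - (P * 0 - 0\<^sup>2 / 2)"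
      unfolding T_def by (rule area(2)) (use P0 in \<open>auto intro!: derivative_eq_intros\<close>)
    have "1 = vol {1, 2} ({1, 2} \<rightarrow>\<^sub>E {0..1})"
      using vol_box[of "{1::nat, 2}" "\<lambda>_. 0" "\<lambda>_. 1"] by simp
    also have "\<dots> \<le> vol {1, 2} (?D \<union> T)"
      unfolding vol_def
    proof (rule measure_mono_fmeasurable)
      show "{1, 2} \<rightarrow>\<^sub>E {0..1} \<subseteq> ?D \<union> T"
        unfolding subset_iff Un_iff D_iff unit_square_iff T_def mem_Collect_eq by force
      show "({1, 2} \<rightarrow>\<^sub>E {0..1}) \<in> sets (leb {1, 2})" by (rule cube_sets) simp
      show "?D \<union> T \<in> fmeasurable (leb {1, 2})" using D_fm T_fm by (rule fmeasurable.Un)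
    qed
    also have "\<dots> \<le> vol {1, 2} ?D + vol {1, 2} T"
      unfolding vol_def by (rule measure_Un_le) (use Dsets T_fm in auto)
    finally have "1 - P\<^sup>2 / 2 \<le> vol {1, 2} ?D" using T_vol by (simp add: power2_eq_square)
    moreover have "P\<^sup>2 \<le> (2/3)\<^sup>2" using P0 P23 by (intro power_mono) auto
    moreover have "face {1, 2} q {1} \<subseteq> {2} \<rightarrow>\<^sub>E {0..1}" "face {1, 2} q {2} \<subseteq> {1} \<rightarrow>\<^sub>E {0..1}"
      unfolding face_def minus by blast+
    then have "vol {2} (face {1, 2} q {1}) \<le> 1" "vol {1} (face {1, 2} q {2}) \<le> 1"
      by (simp_all add: vol_cube_le_1)
    ultimately show ?thesis using dN by (simp add: power2_eq_square)
  next
    case False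
    have "?D = {x \<in> space (leb {1, 2}). P - 1 \<le> x 2 \<and> x 2 \<le> 1 \<and> P - x 2 \<le> x 1 \<and> x 1 \<le> 1}"
      using False by (intro set_eqI) (simp only: D_iff mem_Collect_eq, auto)
    also have "vol {1, 2} \<dots> = ((1 - P) * 1 + 1\<^sup>2 / 2) - ((1 - P) * (P - 1) + (P - 1)\<^sup>2 / 2)"
      by (rule vol_between_graphs[where l = "\<lambda>x. P - x" and u = "\<lambda>_. 1" and U = "\<lambda>x. (1 - P) * x + x\<^sup>2 / 2"])
         (use P2 in \<open>auto intro!: derivative_eq_intros\<close>)
    also have "\<dots> = (2 - P)\<^sup>2 / 2" by (simp add: power2_eq_square field_simps)
    finally have vD: "vol {1, 2} ?D = (2 - P)\<^sup>2 / 2" .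
    have "face {1, 2} q {1} = {x \<in> {2} \<rightarrow>\<^sub>E {0..1}. P - 1 \<le> x 2}"
      "face {1, 2} q {2} = {x \<in> {1} \<rightarrow>\<^sub>E {0..1}. P - 1 \<le> x 1}"
      unfolding uniform_pair_face[OF q] minus by (simp_all add: fill_def algebra_simps)
    then have "face {1, 2} q {1} = {2} \<rightarrow>\<^sub>E {P - 1..1}" "face {1, 2} q {2} = {1} \<rightarrow>\<^sub>E {P - 1..1}"
      using unit_interval_above[of "P - 1"] False by simp_all
    then have facets: "vol {2} (face {1, 2} q {1}) = 2 - P" "vol {1} (face {1, 2} q {2}) = 2 - P"
      using vol_box[of "{1}" "\<lambda>_. P - 1" "\<lambda>_. 1"] vol_box[of "{2}" "\<lambda>_. P - 1" "\<lambda>_. 1"] P2 by simp_all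
    have "delta 2 q {1, 2} = (2 - P) * ((2 - P) / 2 - 2 / 3)"
      unfolding dN vD facets by (simp add: power2_eq_square field_simps)
    then show ?thesis using False P2 by simp
  qed
qed

section \<open>Nondegenerate schedules with sign conditions are SJA\<close>

theorem theorem24:
  fixes n :: nat and q :: "nat set \<Rightarrow> real"
  assumes "n \<ge> 1"
    and "price_schedule n q" and "normalized n q"
    and "submodular n q" and "symmetric n q" and "\<not> degenerate n q"
    and "\<exists>I\<subseteq>{1..n}. I \<noteq> {} \<and> vol {1..n} (region n q I) > 0"
    and "\<And>I. \<lbrakk>I \<subseteq> {1..n}; I \<noteq> {}; \<not> tight n q I; vol {1..n} (region n q I) > 0\<rbrakk>
           \<Longrightarrow> delta n q I = 0"
    and "\<And>I. \<lbrakk>I \<subseteq> {1..n}; I \<noteq> {}; \<not> tight n q I; vol {1..n} (region n q I) = 0\<rbrakk>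
           \<Longrightarrow> delta n q I \<ge> 0"
    and "\<And>I. \<lbrakk>I \<subseteq> {1..n}; I \<noteq> {}; left_tight n q I; \<not> right_tight n q I\<rbrakk>
           \<Longrightarrow> delta n q I \<ge> 0"
    and "\<And>I. \<lbrakk>I \<subseteq> {1..n}; I \<noteq> {}; right_tight n q I; \<not> left_tight n q I;
             vol {1..n} (region n q I) > 0\<rbrakk> \<Longrightarrow> delta n q I \<le> 0"
  shows "q = SJA n"
proof -
  note n = assms(1) and ps = assms(2) and norm = assms(3) and sub = assms(4)
    and sym = assms(5) and nd = assms(6)
  have q0: "q {} = 0" by (rule price_empty[OF ps])
  note mono = normalized_monotone[OF norm]
  let ?V = "\<lambda>I. vol {1..n} (region n q I)"
  have not_tight: "\<not> tight n q I" if "I \<subseteq> {1..n}" for I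
    using nd that unfolding degenerate_def by blast
  have d0: "delta n q I = 0" if "I \<subseteq> {1..n}" "I \<noteq> {}" "0 < ?V I" for I
    by (rule assms(8)) (use that not_tight in auto)
  have dnn: "0 \<le> delta n q I" if "I \<subseteq> {1..n}" "I \<noteq> {}" for I
  proof (cases "?V I = 0")
    case True
    then show ?thesis using assms(9) that not_tight by blast
  next
    case False
    then have "0 < ?V I" using vol_nonneg[of "{1..n}" "region n q I"] by linarith
    then show ?thesis using d0 that by simp
  qed
  note null = null_region_bundle[OF norm sub sym nd]
  have pos: "0 < ?V I" if "I \<subset> {1..n}" "card I \<noteq> n - 1" for I
    using null(1)[OF that(1)] that(2) vol_nonneg[of "{1..n}" "region n q I"] by fastforce
  have full: "0 < ?V {1..n}"
  proof (cases "\<exists>i\<in>{1..n}. 0 < ?V {i}")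
    case True
    then obtain i where i: "i \<in> {1..n}" "0 < ?V {i}" by blast
    have "q {i} < 1" by (rule single_price_less_1[where n = n, OF i(1) _ i(2)]) (rule q0)
    moreover have "q {j} = q {i}" if "j \<in> {1..n}" for j
      using sym that i unfolding symmetric_def by simp
    ultimately show ?thesis by (intro vol_region_full_pos[OF sub q0 mono]) auto
  next
    case False
    obtain I where I: "I \<subseteq> {1..n}" "I \<noteq> {}" "0 < ?V I" using assms(7) by blast
    show ?thesis
    proof (cases "I = {1..n}")
      case nI: False
      have "\<not> 0 < ?V {1}" using False n by simp
      (* Otherwise a single item has size other than n - 1, so its region is not null. *)
      have "n = 1 \<or> n = 2"
      proof (rule ccontr)
        assume "\<not> (n = 1 \<or> n = 2)"
        then have n3: "3 \<le> n" using n by linarith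
        have "{1} \<noteq> {1..n}"
        proof
          assume "{1} = {1..n}"
          moreover have "2 \<in> {1..n}" using n3 by simp
          ultimately have "2 \<in> {1::nat}" by blast
          then show False by simp
        qed
        then have "{1} \<subset> {1..n}" using n by (simp add: psubset_eq)
        then have "0 < ?V {1}" by (rule pos) (use n3 in simp)
        with \<open>\<not> 0 < ?V {1}\<close> show False by blast
      qed
      have "finite I" using I finite_subset by blast
      then have "0 < card I" "card I < n"
        using I nI psubset_card_mono[of "{1..n}" I] by (auto simp: card_gt_0_iff)
      then have "card I = 1" using \<open>n = 1 \<or> n = 2\<close> by auto
      then obtain i where "I = {i}" using card_1_singletonE by blast
      with False I show ?thesis by auto
    qed (use I in simp)
  qed
  show ?thesis
  proof (cases "\<exists>I\<subset>{1..n}. ?V I = 0")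
    case False
    then have allpos: "0 < ?V I" if "I \<subseteq> {1..n}" for I
      using full vol_nonneg[of "{1..n}" "region n q I"] that by (cases "I = {1..n}") (auto simp: less_le)
    have "I \<in> bundles n n" if "I \<subseteq> {1..n}" for I
    proof (cases "I = {}")
      case False
      then show ?thesis using that card_mono[OF _ that] by (intro bundlesI) auto
    qed (simp add: bundles_def)
    then have "critical n (bundles n n) q"
      using allpos d0 unfolding critical_def by (auto simp: bundles_def)
    then have "q \<in> sja_candidates n n"
      using ps norm sub sym by (simp add: sja_candidates_def)
    then show ?thesis by (rule SJA_eqI) (use n in auto)
  next
    case True
    then obtain I0 where I0: "I0 \<subset> {1..n}" "?V I0 = 0" by blast
    have I0': "card I0 = n - 1" "q I0 = q {1..n}" by (rule null[OF I0])+
    (* By symmetry one null region makes all regions of size n - 1 null. *)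
    have big: "q I = q {1..n} \<and> ?V I = 0" if I: "I \<subseteq> {1..n}" "card I = n - 1" for I
    proof -
      have "card I = card I0" using I(2) I0'(1) by simp
      then have "q I = q I0"
        using sym I(1) I0(1) unfolding symmetric_def by (meson psubset_imp_subset)
      then have qI: "q I = q {1..n}" using I0'(2) by simp
      have "I \<noteq> {1..n}"
      proof
        assume "I = {1..n}"
        then have "card I = n" by simp
        with I(2) n show False by simp
      qed
      then have "I \<subset> {1..n}" using I(1) by (rule psubsetI[rotated])
      then have "?V I = 0"
        by (rule vol_region_zero_if_price_not_greater[OF _ order_refl]) (simp add: qI)
      with qI show ?thesis by blast
    qed
    have dN: "delta n q {1..n} = 0" using d0[of "{1..n}"] full n by simp
    consider "n = 1" | "n = 2" | "3 \<le> n" using n by linarith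
    then show ?thesis
    proof cases
      case 1
      have "q {1} = 0" using big[of "{}"] q0 1 by simp
      from uniform_single_delta[OF q0 this _ _ n sub mono] have "delta n q {1} \<noteq> 0"
        using 1 by simp
      then show ?thesis using dN 1 by simp
    next
      case 2
      have two: "{1..2} = {1::nat, 2}" by auto
      have reg: "region 2 q {1, 2} = face {1, 2} q {}"
        unfolding region_def face_def two by simp
      have single: "q {1} = q {1, 2}" "q {2} = q {1, 2}"
        using big[of "{1}"] big[of "{2}"] unfolding 2 two by simp_all
      have "0 < vol {1, 2} (face {1, 2} q {})" using full unfolding 2 two reg .
      moreover have "0 \<le> delta 2 q {1}" using dnn[of "{1}"] unfolding 2 by simp
      ultimately have "delta 2 q {1, 2} \<noteq> 0"
        by (rule no_uniform_pair_prices[OF q0 single refl sub[unfolded 2] mono[unfolded 2]])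
      then show ?thesis using dN unfolding 2 two by blast
    next
      case 3
      have iff: "0 < ?V I \<longleftrightarrow> I \<in> bundles (n - 2) n" if I: "I \<subseteq> {1..n}" for I
      proof (cases "card I \<le> n - 2")
        case True
        then have "I \<noteq> {1..n}" using 3 by auto
        then have "0 < ?V I" using pos[of I] I True 3 by auto
        moreover have "I \<in> bundles (n - 2) n"
          using bundlesI[OF I _ True] by (cases "I = {}") (auto simp: bundles_def)
        ultimately show ?thesis by simp
      next
        case False
        from card_subset_cases[OF I False] show ?thesis
        proof
          assume "I = {1..n}"
          then show ?thesis using full by (simp add: bundles_def)
        next
          assume c: "card I = n - 1"
          then have "I \<notin> bundles (n - 2) n" using 3 by (auto simp: bundles_def)
          then show ?thesis using big[OF I c] by simp
        qed
      qed
      have "critical n (bundles (n - 2) n) q"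
        unfolding critical_def
      proof (intro conjI allI impI ballI)
        fix I assume I: "I \<in> bundles (n - 2) n - {{}}"
        then have "I \<subseteq> {1..n}" by (auto simp: bundles_def)
        then show "delta n q I = 0" using d0 iff I by blast
      qed (rule iff)
      then have cand: "q \<in> sja_candidates n (n - 2)"
        using ps norm sub sym by (simp add: sja_candidates_def)
      have sound: "sound_prices n q" by (rule candidate_sound[OF cand]) (use 3 in simp)
      have none: "sja_candidates n n = {}"
      proof (rule no_full_candidate[OF sound _ _ dN])
        show "delta n q J = 0" if "J \<subseteq> {1..n}" "J \<noteq> {}" "card J \<le> n - 2" for J
          using candidateD(6)[OF cand bundlesI[OF that] that(2)] .
        show "0 \<le> delta n q J \<and> q J = q {1..n}" if "J \<subseteq> {1..n}" "card J = n - 1" for J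
        proof -
          have "J \<noteq> {}" using that(2) 3 by auto
          then show ?thesis using dnn[OF that(1)] big[OF that] by blast
        qed
      qed (use 3 in simp)
      (* Only the full bundle has more than n - 1 items, and it belongs to both families anyway. *)
      have bundles_eq: "bundles (n - 1) n = bundles n n"
      proof (intro set_eqI iffI)
        fix I assume "I \<in> bundles n n"
        then have I: "I \<subseteq> {1..n}" by (auto simp: bundles_def)
        show "I \<in> bundles (n - 1) n"
        proof (cases "I = {} \<or> I = {1..n}")
          case False
          then have "card I \<le> n - 1" using card_subset_cases[OF I] by linarith
          then show ?thesis using False by (intro bundlesI[OF I]) auto
        qed (auto simp: bundles_def)
      qed (auto simp: bundles_def)
      show ?thesis
      proof (rule SJA_eqI[OF cand])
        fix j assume "n - 2 < j" "j \<le> n"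
        then have "j = n - 1 \<or> j = n" by linarith
        then show "sja_candidates n j = {}"
          using none bundles_eq by (auto simp: sja_candidates_def)
      qed (use 3 in auto)
    qed
  qed
qed

end
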